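(* Let $n\ge2$. The sequences $0\to I_n^{1',1}\hookrightarrow\Sigma(D_n)\xrightarrow{\gamma}\Sigma(B_{n-2})\to0$ and $0\to\mathring{\mathcal{P}}_n\hookrightarrow\mathcal{P}_n\xrightarrow{\pi}\mathcal{P}_{n-2}\to0$ are exact, the maps $\psi:I_n^{1',1}\to\mathring{\mathcal{P}}_n$, $\psi:\Sigma(D_n)\to\mathcal{P}_n$ and $\varphi:\Sigma(B_{n-2})\to\mathcal{P}_{n-2}$ are well defined and surjective, and the resulting diagram commutes, i.e. $\pi\circ\psi=\varphi\circ\gamma$ on $\Sigma(D_n)$.
   Context: $B_m$: signed permutations $w=w_1\dots w_m$ of $[m]$, values ordered $\cdots<-2<-1<1<2<\cdots$, $w_0=0$, $\mathrm{Des}(w)=\{i\in\{0,\dots,m-1\}:w_i>w_{i+1}\}$; $X_J=\sum_{\mathrm{Des}(w)\subseteq J}w$; $\Sigma(B_m)=\mathrm{span}\{X_J\}$. $D_n\subseteq B_n$: signed permutations with an even number of negative entries; the descent set of $w\in D_n$ is the subset of $\{1',1,\dots,n-1\}$ where $1'$ is a descent iff $-w_1>w_2$ and $i\in[n-1]$ is a descent iff $w_i>w_{i+1}$; $X_J=\sum_{\mathrm{Des}(w)\subseteq J}w$ for $J\subseteq\{1',1,\dots,n-1\}$ and $\Sigma(D_n)=\mathrm{span}\{X_J\}$. $\gamma:\Sigma(D_n)\to\Sigma(B_{n-2})$ is the linear map $X_J\mapsto X_{J-2}$ if $1,1'\notin J$ (so $J\subseteq\{2,\dots,n-1\}$ and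 $J-2\subseteq\{0,\dots,n-3\}$), $X_J\mapsto0$ otherwise. $I_n^{1',1}=\mathrm{span}\{X_J: 1'\in J\text{ or }1\in J\}\subseteq\Sigma(D_n)$. $\varphi$ forgets signs ($w\mapsto|w_1|\dots|w_m|$, linearly), $\psi$ is its restriction to $\mathbb{Q}D_n$. For $u\in\mathfrak{S}_m$: $\mathrm{Peak}(u)=\{i\in[m-1]:u_{i-1}<u_i>u_{i+1}\}$ with $u_0=0$, $\mathring{\mathrm{Peak}}(u)=\mathrm{Peak}(u)\setminus\{1\}$; $\mathcal{F}_m$: subsets of $[m-1]$ with no two consecutive integers, $\mathring{\mathcal{F}}_m=\{F\in\mathcal{F}_m:1\notin F\}$; $P_F=\sum_{\mathrm{Peak}(u)=F}u$, $\mathring{P}_F=\sum_{\mathring{\mathrm{Peak}}(u)=F}u$; $\mathcal{P}_m=\mathrm{span}\{P_F\}$, $\mathring{\mathcal{P}}_n=\mathrm{span}\{\mathring{P}_F\}$, $\mathcal{P}_0=\mathcal{P}_1=\mathbb{Q}$. $\pi:\mathcal{P}_n\to\mathcal{P}_{n-2}$: $P_F\mapsto P_{F-2}$ if $1,2\notin F$; $P_F\mapsto-P_{(F\setminus\{1\})-2}$ if $1\in F$; $P_F\mapsto0$ if $2\in F$. *)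

theory Defs
  imports Complex_Main
begin

(* Signed permutations of [m] are represented as functions w :: nat => int with
   w i = 0 for i outside {1..m} (so in particular w 0 = 0, matching the convention w_0 = 0),
   and i |-> |w i| a bijection of {1..m}.  Elements of the group algebra Q[B_m]
   are functions (nat => int) => rat (supported on the signed permutations). *)

definition signed_perms :: "nat \<Rightarrow> (nat \<Rightarrow> int) set" where
  "signed_perms m = {w. (\<forall>i. i \<notin> {1..m} \<longrightarrow> w i = 0) \<and>
                        bij_betw (\<lambda>i. nat \<bar>w i\<bar>) {1..m} {1..m}}"

definition perms :: "nat \<Rightarrow> (nat \<Rightarrow> int) set" where
  "perms m = {u \<in> signed_perms m. \<forall>i. u i \<ge> 0}"

definition Dperms :: "nat \<Rightarrow> (nat \<Rightarrow> int) set" where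
  "Dperms n = {w \<in> signed_perms n. even (card {i \<in> {1..n}. w i < 0})}"

definition DesB :: "nat \<Rightarrow> (nat \<Rightarrow> int) \<Rightarrow> nat set" where
  "DesB m w = {i \<in> {0..<m}. w i > w (Suc i)}"

(* type D descent set; the label 1' is encoded as 0, so Des is a subset of {0..n-1} *)
definition DesD :: "nat \<Rightarrow> (nat \<Rightarrow> int) \<Rightarrow> nat set" where
  "DesD n w = {i. i = 0 \<and> - w 1 > w 2} \<union> {i \<in> {1..<n}. w i > w (Suc i)}"

definition XB :: "nat \<Rightarrow> nat set \<Rightarrow> (nat \<Rightarrow> int) \<Rightarrow> rat" where
  "XB m J = (\<lambda>w. if w \<in> signed_perms m \<and> DesB m w \<subseteq> J then 1 else 0)"

definition XD :: "nat \<Rightarrow> nat set \<Rightarrow> (nat \<Rightarrow> int) \<Rightarrow> rat" where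
  "XD n J = (\<lambda>w. if w \<in> Dperms n \<and> DesD n w \<subseteq> J then 1 else 0)"

definition qspan :: "('a \<Rightarrow> rat) set \<Rightarrow> ('a \<Rightarrow> rat) set" where
  "qspan S = {x. \<exists>T c. finite T \<and> T \<subseteq> S \<and> x = (\<lambda>w. \<Sum>v\<in>T. c v * v w)}"

definition linear_on :: "('a \<Rightarrow> rat) set \<Rightarrow> (('a \<Rightarrow> rat) \<Rightarrow> ('b \<Rightarrow> rat)) \<Rightarrow> bool" where
  "linear_on V f \<longleftrightarrow> (\<forall>x\<in>V. \<forall>y\<in>V. \<forall>a b. f (\<lambda>w. a * x w + b * y w) = (\<lambda>w. a * f x w + b * f y w))"

definition SigmaB :: "nat \<Rightarrow> ((nat \<Rightarrow> int) \<Rightarrow> rat) set" where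
  "SigmaB m = qspan {XB m J | J. J \<subseteq> {0..<m}}"

(* Sigma(D_n), J ranges over subsets of {1',1,...,n-1} encoded as {0..n-1} *)
definition SigmaD :: "nat \<Rightarrow> ((nat \<Rightarrow> int) \<Rightarrow> rat) set" where
  "SigmaD n = qspan {XD n J | J. J \<subseteq> {0..<n}}"

definition Iideal :: "nat \<Rightarrow> ((nat \<Rightarrow> int) \<Rightarrow> rat) set" where
  "Iideal n = qspan {XD n J | J. J \<subseteq> {0..<n} \<and> (0 \<in> J \<or> 1 \<in> J)}"

(* forgetting signs, phi on Q[B_m]; psi is forget n restricted to Q[D_n] *)
definition forget :: "nat \<Rightarrow> ((nat \<Rightarrow> int) \<Rightarrow> rat) \<Rightarrow> ((nat \<Rightarrow> int) \<Rightarrow> rat)" where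
  "forget m x = (\<lambda>u. \<Sum>w\<in>{w \<in> signed_perms m. (\<lambda>i. \<bar>w i\<bar>) = u}. x w)"

definition Peak :: "nat \<Rightarrow> (nat \<Rightarrow> int) \<Rightarrow> nat set" where
  "Peak m u = {i \<in> {1..<m}. u (i - 1) < u i \<and> u i > u (Suc i)}"

definition peak_sets :: "nat \<Rightarrow> nat set set" where
  "peak_sets m = {F. F \<subseteq> {1..<m} \<and> (\<forall>i\<in>F. Suc i \<notin> F)}"

definition PF :: "nat \<Rightarrow> nat set \<Rightarrow> (nat \<Rightarrow> int) \<Rightarrow> rat" where
  "PF m F = (\<lambda>u. if u \<in> perms m \<and> Peak m u = F then 1 else 0)"

definition PFring :: "nat \<Rightarrow> nat set \<Rightarrow> (nat \<Rightarrow> int) \<Rightarrow> rat" where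
  "PFring m F = (\<lambda>u. if u \<in> perms m \<and> Peak m u - {1} = F then 1 else 0)"

(* peak algebra P_m (for m = 0,1 this is the one-dimensional Q S_m = Q) *)
definition PP :: "nat \<Rightarrow> ((nat \<Rightarrow> int) \<Rightarrow> rat) set" where
  "PP m = qspan {PF m F | F. F \<in> peak_sets m}"

definition PPring :: "nat \<Rightarrow> ((nat \<Rightarrow> int) \<Rightarrow> rat) set" where
  "PPring m = qspan {PFring m F | F. F \<in> peak_sets m \<and> 1 \<notin> F}"

end

theory Submission
  imports Defs
begin

text \<open>
  Put \<open>m = n - 2\<close>.  Both \<open>\<gamma>\<close> and \<open>\<pi>\<close> are restrictions of explicit linear maps on the whole group
  algebras: the coefficient of \<open>\<gamma> x\<close> at \<open>v\<close> is an alternating sum of the coefficients of \<open>x\<close> at the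
  signed permutations \<open>(\<plusminus>1, \<plusminus>2, v)\<close> and \<open>(\<plusminus>2, \<plusminus>1, v)\<close>, with the letters of \<open>v\<close> moved away from \<open>0\<close>
  by two, and the coefficient of \<open>\<pi> x\<close> at \<open>u\<close> is the difference of those at \<open>(1, 2, u)\<close> and
  \<open>(2, 1, u)\<close>.  In this form \<open>\<pi> \<circ> \<psi> = \<phi> \<circ> \<gamma>\<close> is a regrouping of sums, and the kernels are obtained
  from linear sections of \<open>\<gamma>\<close> and \<open>\<pi>\<close>.  For the images under \<open>\<phi>\<close>, counting sign choices letter by
  letter gives \<open>\<phi>(X\<^sub>J) = 2\<^bsup>|J|\<^esup> \<Sum> P\<^sub>F\<close> over \<open>F \<subseteq> J \<union> (J + 1)\<close>; with \<open>J = F - 1\<close> this is triangular with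
  respect to the sum of the elements of \<open>F\<close>.  Type D reduces to type B, since \<open>\<psi>(X\<^sub>J)\<close> is
  \<open>\<phi>(X\<^sub>J)\<close> if \<open>1', 1 \<notin> J\<close>, half of it if \<open>1' \<in> J\<close>, and symmetric under exchanging \<open>1'\<close> and \<open>1\<close>.
\<close>

section \<open>Rational spans\<close>

lemma qspan_zero: "(\<lambda>_. 0) \<in> qspan S"
  unfolding qspan_def by (auto intro!: exI[of _ "{}"])

lemma qspan_add_scale:
  assumes "x \<in> qspan S" "y \<in> S"
  shows "(\<lambda>w. x w + a * y w) \<in> qspan S"
proof -
  obtain T c where T: "finite T" "T \<subseteq> S" and x: "x = (\<lambda>w. \<Sum>v\<in>T. c v * v w)"
    using assms(1) unfolding qspan_def by auto
  \<comment> \<open>\<open>y\<close> may already lie in \<open>T\<close>, so its old coefficient and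
    \<open>a\<close> are added up.\<close>
  define c' where "c' v = (if v \<in> T then c v else 0) + (if v = y then a else 0)" for v
  have "x w + a * y w = (\<Sum>v\<in>insert y T. c' v * v w)" for w
  proof -
    have "(\<Sum>v\<in>insert y T. c' v * v w)
        = (\<Sum>v\<in>insert y T. if v \<in> T then c v * v w else 0)
          + (\<Sum>v\<in>insert y T. if v = y then a * y w else 0)"
      unfolding sum.distrib[symmetric] by (intro sum.cong) (auto simp: c'_def algebra_simps)
    also have "(\<Sum>v\<in>insert y T. if v \<in> T then c v * v w else 0) = (\<Sum>v\<in>T. c v * v w)"
      using T(1) by (intro sum.mono_neutral_cong_right) auto
    also have "(\<Sum>v\<in>insert y T. if v = y then a * y w else 0) = a * y w"
      using T(1) by (simp add: sum.delta)
    finally show ?thesis by (simp add: x)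
  qed
  then show ?thesis
    unfolding qspan_def using T assms(2)
    by (auto intro!: exI[of _ "insert y T"] exI[of _ c'])
qed

lemma qspan_base: "x \<in> S \<Longrightarrow> x \<in> qspan S"
  using qspan_add_scale[OF qspan_zero, of x S 1] by simp

text \<open>Spans grow by one scaled generator at a time, so closure properties and identities of
  linear maps need checking for a single such step only.\<close>

lemma qspan_induct [consumes 1, case_names zero step]:
  assumes "x \<in> qspan S" and "P (\<lambda>_. 0)"
    and step: "\<And>x y a. x \<in> qspan S \<Longrightarrow> P x \<Longrightarrow> y \<in> S \<Longrightarrow> P (\<lambda>w. x w + a * y w)"
  shows "P x"
proof -
  obtain T c where T: "finite T" "T \<subseteq> S" and x: "x = (\<lambda>w. \<Sum>v\<in>T. c v * v w)"
    using assms(1) unfolding qspan_def by auto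
  \<comment> \<open>Membership in the span is carried along because the step case assumes
    it.\<close>
  have "P (\<lambda>w. \<Sum>v\<in>T. c v * v w) \<and> (\<lambda>w. \<Sum>v\<in>T. c v * v w) \<in> qspan S"
    using T
  proof (induction T rule: finite_induct)
    case empty
    then show ?case using assms(2) qspan_zero by simp
  next
    case (insert y T)
    then have "y \<in> S" "P (\<lambda>w. \<Sum>v\<in>T. c v * v w)" "(\<lambda>w. \<Sum>v\<in>T. c v * v w) \<in> qspan S"
      by auto
    from step[OF this(3,2,1), of "c y"] qspan_add_scale[OF this(3,1), of "c y"]
    show ?case using insert.hyps by (simp add: add.commute)
  qed
  then show ?thesis using x by simp
qed

lemma qspan_lincomb:
  assumes "x \<in> qspan S" "y \<in> qspan S"
  shows "(\<lambda>w. a * x w + b * y w) \<in> qspan S"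
proof -
  have scale: "(\<lambda>w. a * x w) \<in> qspan S"
    using assms(1)
  proof (induction rule: qspan_induct)
    case zero
    then show ?case by (simp add: qspan_zero)
  next
    case (step x y c)
    from qspan_add_scale[OF step.IH step.hyps(2), of "a * c"] show ?case
      by (simp add: algebra_simps)
  qed
  from assms(2) show ?thesis
  proof (induction rule: qspan_induct)
    case zero
    then show ?case using scale by simp
  next
    case (step y z c)
    from qspan_add_scale[OF step.IH step.hyps(2), of "b * c"] show ?case
      by (simp add: algebra_simps)
  qed
qed

lemma qspan_scale: "x \<in> qspan S \<Longrightarrow> (\<lambda>w. a * x w) \<in> qspan S"
  using qspan_lincomb[of x S x a 0] by simp

lemma qspan_sum:
  assumes "\<And>i. i \<in> A \<Longrightarrow> f i \<in> qspan S"
  shows "(\<lambda>w. \<Sum>i\<in>A. c i * f i w) \<in> qspan S"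
  using assms
proof (induction A rule: infinite_finite_induct)
  case (insert i A)
  have "(\<lambda>w. c i * f i w + 1 * (\<Sum>i\<in>A. c i * f i w)) \<in> qspan S"
    using insert by (intro qspan_lincomb) auto
  then show ?case using insert.hyps by simp
qed (auto simp: qspan_zero)

section \<open>Linear maps on spans\<close>

lemma linear_on_subset: "linear_on V f \<Longrightarrow> U \<subseteq> V \<Longrightarrow> linear_on U f"
  unfolding linear_on_def by blast

lemma linear_on_lincomb:
  "linear_on UNIV f \<Longrightarrow> f (\<lambda>w. a * x w + b * y w) = (\<lambda>w. a * f x w + b * f y w)"
  unfolding linear_on_def by blast

lemma linear_on_add_scale:
  "linear_on UNIV f \<Longrightarrow> f (\<lambda>w. x w + a * y w) = (\<lambda>w. f x w + a * f y w)"
  using linear_on_lincomb[of f 1 x a y] by simp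

lemma linear_on_zero: "linear_on UNIV f \<Longrightarrow> f (\<lambda>_. 0) = (\<lambda>_. 0)"
  using linear_on_lincomb[of f 0 "\<lambda>_. 0" 0 "\<lambda>_. 0"] by simp

lemma qspan_subset:
  assumes "S \<subseteq> qspan T"
  shows "qspan S \<subseteq> qspan T"
proof
  fix x assume "x \<in> qspan S"
  then show "x \<in> qspan T"
  proof (induction rule: qspan_induct)
    case zero
    then show ?case by (rule qspan_zero)
  next
    case (step x y a)
    then have "y \<in> qspan T" using assms by blast
    from qspan_lincomb[OF step.IH this, of 1 a] show ?case by simp
  qed
qed

lemma linear_image_qspan:
  assumes "linear_on UNIV f"
  shows "f ` qspan S = qspan (f ` S)"
proof
  show "f ` qspan S \<subseteq> qspan (f ` S)"
  proof
    fix z assume "z \<in> f ` qspan S"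
    then obtain x where x: "x \<in> qspan S" and z: "z = f x" by blast
    from x show "z \<in> qspan (f ` S)" unfolding z
    proof (induction rule: qspan_induct)
      case zero
      then show ?case by (simp add: linear_on_zero[OF assms] qspan_zero)
    next
      case (step x y a)
      then show ?case
        by (simp add: linear_on_add_scale[OF assms] qspan_add_scale)
    qed
  qed
  show "qspan (f ` S) \<subseteq> f ` qspan S"
  proof
    fix z assume "z \<in> qspan (f ` S)"
    then show "z \<in> f ` qspan S"
    proof (induction rule: qspan_induct)
      case zero
      show ?case using linear_on_zero[OF assms] qspan_zero[of S] by (metis imageI)
    next
      case (step z y a)
      then obtain x y' where "x \<in> qspan S" "z = f x" "y' \<in> S" "y = f y'" by blast
      then have "(\<lambda>w. z w + a * y w) = f (\<lambda>w. x w + a * y' w)"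
        "(\<lambda>w. x w + a * y' w) \<in> qspan S"
        by (auto simp: linear_on_add_scale[OF assms] qspan_add_scale)
      then show ?case by blast
    qed
  qed
qed

lemma linear_image_qspan_subset:
  assumes "linear_on UNIV f" "\<And>x. x \<in> S \<Longrightarrow> f x \<in> qspan T"
  shows "f ` qspan S \<subseteq> qspan T"
  using assms(2) unfolding linear_image_qspan[OF assms(1)] by (intro qspan_subset) blast

lemma qspan_subset_linear_image:
  assumes "linear_on UNIV f" "\<And>y. y \<in> T \<Longrightarrow> y \<in> f ` qspan S"
  shows "qspan T \<subseteq> f ` qspan S"
  using assms(2) unfolding linear_image_qspan[OF assms(1)] by (intro qspan_subset) blast

text \<open>A linear section \<open>s\<close> of \<open>f\<close> makes \<open>x - s (f x)\<close> a projection onto the kernel,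
  so the kernel is found by projecting generators, without any linear independence.\<close>

lemma kernel_qspan:
  assumes f: "linear_on UNIV f" and s: "linear_on UNIV s"
    and proj: "\<And>x. x \<in> S \<Longrightarrow> (\<lambda>w. x w - s (f x) w) \<in> qspan T"
    and T: "T \<subseteq> qspan S" and ker: "\<And>x. x \<in> T \<Longrightarrow> f x = (\<lambda>_. 0)"
  shows "{x \<in> qspan S. f x = (\<lambda>_. 0)} = qspan T"
proof (intro equalityI subsetI)
  fix x assume "x \<in> {x \<in> qspan S. f x = (\<lambda>_. 0)}"
  then have x: "x \<in> qspan S" and fx: "f x = (\<lambda>_. 0)" by auto
  from x have "(\<lambda>w. x w - s (f x) w) \<in> qspan T"
  proof (induction rule: qspan_induct)
    case zero
    then show ?case by (simp add: linear_on_zero[OF f] linear_on_zero[OF s] qspan_zero)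
  next
    case (step x y a)
    from qspan_lincomb[OF step.IH proj[OF step.hyps(2)], of 1 a] show ?case
      by (simp add: linear_on_add_scale[OF f] linear_on_add_scale[OF s] algebra_simps)
  qed
  then show "x \<in> qspan T" by (simp add: fx linear_on_zero[OF s])
next
  fix x assume x: "x \<in> qspan T"
  then have "x \<in> qspan S" using qspan_subset[OF T] by blast
  moreover from x have "f x = (\<lambda>_. 0)"
  proof (induction rule: qspan_induct)
    case zero
    then show ?case by (simp add: linear_on_zero[OF f])
  next
    case (step x y a)
    then show ?case by (simp add: linear_on_add_scale[OF f] ker)
  qed
  ultimately show "x \<in> {x \<in> qspan S. f x = (\<lambda>_. 0)}" by simp
qed

section \<open>Signed permutations and their signs\<close>

text \<open>Only absolute values matter for membership, so every change of signs stays inside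
  \<open>signed_perms m\<close>.\<close>

lemma signed_perms_iff_abs: "w \<in> signed_perms m \<longleftrightarrow> (\<lambda>i. \<bar>w i\<bar>) \<in> perms m"
  by (simp add: perms_def signed_perms_def)

lemma perms_abs: "u \<in> perms m \<Longrightarrow> \<bar>u i\<bar> = u i"
  by (auto simp: perms_def)

lemma perms_signed: "u \<in> perms m \<Longrightarrow> u \<in> signed_perms m"
  by (simp add: perms_def)

lemma signed_perms_outside: "w \<in> signed_perms m \<Longrightarrow> i \<notin> {1..m} \<Longrightarrow> w i = 0"
  by (simp add: signed_perms_def)

lemma signed_perms_range:
  assumes "w \<in> signed_perms m" "i \<in> {1..m}"
  shows "\<bar>w i\<bar> \<in> {1..int m}"
proof -
  have "nat \<bar>w i\<bar> \<in> {1..m}"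
    using assms by (auto simp: signed_perms_def dest: bij_betwE)
  then show ?thesis by auto
qed

lemma signed_perms_nonzero: "w \<in> signed_perms m \<Longrightarrow> i \<in> {1..m} \<Longrightarrow> w i \<noteq> 0"
  using signed_perms_range[of w m i] by auto

lemma signed_perms_inj:
  assumes "w \<in> signed_perms m" "i \<in> {1..m}" "j \<in> {1..m}" "\<bar>w i\<bar> = \<bar>w j\<bar>"
  shows "i = j"
proof -
  have "inj_on (\<lambda>i. nat \<bar>w i\<bar>) {1..m}"
    using assms(1) by (auto simp: signed_perms_def bij_betw_def)
  then show ?thesis using assms(2-4) by (auto elim!: inj_onD)
qed

text \<open>Position 0 is included: there \<open>w 0 = 0\<close> is compared with a nonzero letter.
  Hence non-descents are strict ascents at all positions.\<close>

lemma signed_perms_adjacent: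
  assumes "w \<in> signed_perms m" "i < m"
  shows "\<bar>w i\<bar> \<noteq> \<bar>w (Suc i)\<bar>"
proof (cases "i = 0")
  case True
  then show ?thesis
    using signed_perms_nonzero[OF assms(1), of "Suc i"] signed_perms_outside[OF assms(1), of 0] assms(2)
    by auto
next
  case False
  then show ?thesis using signed_perms_inj[OF assms(1), of i "Suc i"] assms(2) by auto
qed

text \<open>Injectivity suffices, since an injective map of a finite set into itself is
  onto.\<close>

lemma signed_permsI:
  assumes "\<And>i. i \<notin> {1..m} \<Longrightarrow> w i = 0"
    and "\<And>i. i \<in> {1..m} \<Longrightarrow> \<bar>w i\<bar> \<in> {1..int m}"
    and "\<And>i j. i \<in> {1..m} \<Longrightarrow> j \<in> {1..m} \<Longrightarrow> \<bar>w i\<bar> = \<bar>w j\<bar> \<Longrightarrow> i = j"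
  shows "w \<in> signed_perms m"
proof -
  let ?f = "\<lambda>i. nat \<bar>w i\<bar>"
  have "inj_on ?f {1..m}"
    using assms(3) by (intro inj_onI) (auto simp: nat_eq_iff)
  moreover have "?f ` {1..m} \<subseteq> {1..m}"
    using assms(2) by force
  ultimately have "bij_betw ?f {1..m} {1..m}"
    by (simp add: bij_betw_def endo_inj_surj)
  then show ?thesis using assms(1) by (simp add: signed_perms_def)
qed

text \<open>The parity of the number of negative letters in multiplicative form: a sign change of
  one letter simply contributes a factor -1.\<close>

definition sign_prod :: "nat \<Rightarrow> (nat \<Rightarrow> int) \<Rightarrow> int" where
  "sign_prod n w = (\<Prod>i\<in>{1..n}. sgn (w i))"

lemma prod_sgn:
  fixes w :: "nat \<Rightarrow> int"
  assumes "finite A" "\<And>i. i \<in> A \<Longrightarrow> w i \<noteq> 0"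
  shows "(\<Prod>i\<in>A. sgn (w i)) = (- 1) ^ card {i \<in> A. w i < 0}"
proof -
  have "(\<Prod>i\<in>A. sgn (w i)) = (\<Prod>i\<in>A. if w i < 0 then - 1 else 1)"
    using assms(2) by (intro prod.cong) (auto simp: sgn_if)
  also have "\<dots> = (- 1) ^ card {i \<in> A. w i < 0}"
    using assms(1) by (simp add: prod.If_cases Int_def)
  finally show ?thesis .
qed

lemma sign_prod_cases: "w \<in> signed_perms n \<Longrightarrow> sign_prod n w = 1 \<or> sign_prod n w = - 1"
  using prod_sgn[of "{1..n}" w] signed_perms_nonzero[of w n]
  by (simp add: sign_prod_def minus_one_power_iff)

lemma Dperms_iff_sign_prod: "w \<in> Dperms n \<longleftrightarrow> w \<in> signed_perms n \<and> sign_prod n w = 1"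
proof -
  have "even (card {i \<in> {1..n}. w i < 0}) \<longleftrightarrow> sign_prod n w = 1" if "w \<in> signed_perms n"
    using prod_sgn[of "{1..n}" w] signed_perms_nonzero[OF that]
    by (cases "even (card {i \<in> {1..n}. w i < 0})") (auto simp: sign_prod_def)
  then show ?thesis by (auto simp: Dperms_def)
qed

section \<open>Forgetting signs in type B\<close>

text \<open>For a permutation \<open>u\<close> this is the part of the fibre of
  \<open>forget\<close> over \<open>u\<close> with descents in \<open>J\<close>. It is defined for
  prefixes of any \<open>u\<close>, since the induction cuts off the last letter and a prefix of a
  permutation of \<open>[m]\<close> need not be a permutation of a smaller
  \<open>[k]\<close>.\<close>

definition signings :: "(nat \<Rightarrow> int) \<Rightarrow> nat \<Rightarrow> nat set \<Rightarrow> (nat \<Rightarrow> int) set" where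
  "signings u m J = {v. (\<forall>i\<le>m. \<bar>v i\<bar> = u i) \<and> (\<forall>i>m. v i = 0) \<and>
                        (\<forall>i<m. i \<notin> J \<longrightarrow> v i < v (Suc i))}"

text \<open>Deleting the last letter \<open>c\<close> loses only the ascent condition at position
  \<open>m\<close>.\<close>

lemma signings_Suc_fibre:
  assumes "\<bar>c\<bar> = u (Suc m)"
  shows "{v \<in> signings u (Suc m) J. v (Suc m) = c}
    = (\<lambda>v. v(Suc m := c)) ` {v \<in> signings u m J. m \<in> J \<or> v m < c}"
proof (intro equalityI subsetI)
  fix v assume v: "v \<in> {v \<in> signings u (Suc m) J. v (Suc m) = c}"
  let ?v = "v(Suc m := 0)"
  have "?v \<in> signings u m J" "m \<in> J \<or> ?v m < c" "v = ?v(Suc m := c)"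
    using v by (auto simp: signings_def fun_eq_iff less_Suc_eq)
  then show "v \<in> (\<lambda>v. v(Suc m := c)) ` {v \<in> signings u m J. m \<in> J \<or> v m < c}"
    by blast
next
  fix v assume "v \<in> (\<lambda>v. v(Suc m := c)) ` {v \<in> signings u m J. m \<in> J \<or> v m < c}"
  then show "v \<in> {v \<in> signings u (Suc m) J. v (Suc m) = c}"
    using assms by (auto simp: signings_def less_Suc_eq le_Suc_eq)
qed

lemma card_signings_Suc_fibre:
  assumes "\<bar>c\<bar> = u (Suc m)"
  shows "card {v \<in> signings u (Suc m) J. v (Suc m) = c}
    = card {v \<in> signings u m J. m \<in> J \<or> v m < c}"
proof -
  have "inj_on (\<lambda>v. v(Suc m := c)) {v \<in> signings u m J. m \<in> J \<or> v m < c}"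
  proof (rule inj_onI)
    fix v v' :: "nat \<Rightarrow> int"
    assume "v \<in> {v \<in> signings u m J. m \<in> J \<or> v m < c}"
      "v' \<in> {v \<in> signings u m J. m \<in> J \<or> v m < c}"
      and eq: "v(Suc m := c) = v'(Suc m := c)"
    then have "v (Suc m) = v' (Suc m)" by (simp add: signings_def)
    with eq show "v = v'" by (metis fun_upd_triv fun_upd_upd)
  qed
  then show ?thesis by (simp add: signings_Suc_fibre[of c u m J, OF assms] card_image)
qed

lemma signings_Suc_split:
  "signings u (Suc m) J = {v \<in> signings u (Suc m) J. v (Suc m) = u (Suc m)}
     \<union> {v \<in> signings u (Suc m) J. v (Suc m) = - u (Suc m)}"
  by (auto simp: signings_def abs_if split: if_splits)

lemma finite_signings:
  assumes "\<And>i. 0 \<le> u i"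
  shows "finite (signings u m J)"
proof (induction m)
  case 0
  have "signings u 0 J \<subseteq> {(\<lambda>_. 0)(0 := u 0), (\<lambda>_. 0)(0 := - u 0)}"
  proof
    fix v assume "v \<in> signings u 0 J"
    then have "v = (\<lambda>_. 0)(0 := v 0)" "\<bar>v 0\<bar> = u 0"
      by (auto simp: signings_def fun_eq_iff)
    then show "v \<in> {(\<lambda>_. 0)(0 := u 0), (\<lambda>_. 0)(0 := - u 0)}"
      by (metis abs_if insertCI minus_minus)
  qed
  then show ?case by (rule finite_subset) simp
next
  case (Suc m)
  have "finite {v \<in> signings u (Suc m) J. v (Suc m) = c}" if "\<bar>c\<bar> = u (Suc m)" for c
    unfolding signings_Suc_fibre[of c u m J, OF that] using Suc by simp
  then show ?case
    by (subst signings_Suc_split) (use assms in simp)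
qed

text \<open>Besides the number of signings one has to count those with a negative last letter:
  these are the ones surviving a descent of \<open>u\<close> outside \<open>J\<close>.\<close>

lemma card_signings_aux:
  assumes "\<And>i. 0 \<le> u i" "u 0 = 0" "\<And>i. i < m \<Longrightarrow> u i \<noteq> u (Suc i)"
    "\<And>i. i \<in> {1..m} \<Longrightarrow> u i \<noteq> 0"
  shows "card (signings u m J) =
      (if \<forall>i\<in>{1..<m}. u (i - 1) < u i \<and> u i > u (Suc i) \<longrightarrow> i \<in> J \<or> i - 1 \<in> J
       then 2 ^ card (J \<inter> {..<m}) else 0) \<and>
    2 * card {v \<in> signings u m J. v m < 0} =
      (if m = 0 \<or> (m - 1 \<notin> J \<and> u (m - 1) < u m) then 0 else card (signings u m J))"
  using assms(3,4)
proof (induction m)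
  case 0
  have "signings u 0 J = {\<lambda>_. 0}"
  proof (intro equalityI subsetI)
    fix v assume "v \<in> signings u 0 J"
    then have "v i = 0" for i using assms(2) by (cases "i = 0") (auto simp: signings_def)
    then show "v \<in> {\<lambda>_. 0}" by auto
  qed (use assms(2) in \<open>auto simp: signings_def\<close>)
  then have "card (signings u 0 J) = 1" "{v \<in> signings u 0 J. v 0 < 0} = {}"
    by auto
  then show ?case by (simp only: card.empty) simp
next
  case (Suc m)
  let ?P = "\<lambda>m. \<forall>i\<in>{1..<m}. u (i - 1) < u i \<and> u i > u (Suc i) \<longrightarrow> i \<in> J \<or> i - 1 \<in> J"
  let ?S = "signings u m J" and ?S' = "signings u (Suc m) J"
  let ?N = "card {v \<in> ?S. v m < 0}" and ?T = "card ?S"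
  let ?N' = "card {v \<in> ?S'. v (Suc m) < 0}" and ?T' = "card ?S'"
  have IH: "?T = (if ?P m then 2 ^ card (J \<inter> {..<m}) else 0)"
      "2 * ?N = (if m = 0 \<or> (m - 1 \<notin> J \<and> u (m - 1) < u m) then 0 else ?T)"
    using Suc.IH Suc.prems by auto
  have pos: "u (Suc m) > 0" using Suc.prems(2)[of "Suc m"] assms(1)[of "Suc m"] by simp
  have fin: "finite ?S'" "finite ?S" by (rule finite_signings[OF assms(1)])+
  have neg: "{v \<in> ?S'. v (Suc m) < 0} = {v \<in> ?S'. v (Suc m) = - u (Suc m)}"
    using pos by (auto simp: signings_def abs_if split: if_splits)
  have N': "?N' = card {v \<in> ?S. m \<in> J \<or> v m < - u (Suc m)}"
    unfolding neg using pos by (intro card_signings_Suc_fibre) simp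
  have "?T' = card {v \<in> ?S'. v (Suc m) = u (Suc m)} + ?N'"
    unfolding neg
    by (subst signings_Suc_split, rule card_Un_disjoint) (use fin pos in auto)
  also have "card {v \<in> ?S'. v (Suc m) = u (Suc m)} = card {v \<in> ?S. m \<in> J \<or> v m < u (Suc m)}"
    using pos by (intro card_signings_Suc_fibre) simp
  finally have T': "?T' = card {v \<in> ?S. m \<in> J \<or> v m < u (Suc m)} + ?N'" .
  have abs_v: "\<bar>v m\<bar> = u m" if "v \<in> ?S" for v using that by (simp add: signings_def)
  have PS: "?P (Suc m) \<longleftrightarrow> ?P m \<and> (m \<noteq> 0 \<and> u (m - 1) < u m \<and> u m > u (Suc m) \<longrightarrow> m \<in> J \<or> m - 1 \<in> J)"
    by (auto simp: less_Suc_eq)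
  \<comment> \<open>If \<open>m\<close> is in \<open>J\<close>, the sign of the new letter is free.
    Otherwise an ascent of \<open>u\<close> forces the new letter to be positive, whereas a descent
    forces \<open>v m\<close> to be negative and leaves the new sign free.\<close>
  consider (J) "m \<in> J" | (up) "m \<notin> J" "u m < u (Suc m)" | (down) "m \<notin> J" "u m > u (Suc m)"
    using Suc.prems(1)[of m] by force
  then show ?case
  proof cases
    case J
    then have "?N' = ?T" "?T' = 2 * ?T" using N' T' by auto
    moreover have "J \<inter> {..<Suc m} = insert m (J \<inter> {..<m})" using J by auto
    ultimately show ?thesis using J IH(1) PS by simp
  next
    case up
    have "{v \<in> ?S. m \<in> J \<or> v m < - u (Suc m)} = {}" using up abs_v by force
    moreover have "{v \<in> ?S. m \<in> J \<or> v m < u (Suc m)} = ?S" using up abs_v by force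
    ultimately have "?N' = 0" "?T' = ?T" unfolding T' N' by (simp_all only: card.empty add_0_right)
    moreover have "J \<inter> {..<Suc m} = J \<inter> {..<m}" using up by (auto simp: less_Suc_eq)
    ultimately show ?thesis using up IH(1) PS by simp
  next
    case down
    have "{v \<in> ?S. m \<in> J \<or> v m < - u (Suc m)} = {v \<in> ?S. v m < 0}"
      "{v \<in> ?S. m \<in> J \<or> v m < u (Suc m)} = {v \<in> ?S. v m < 0}"
      using down abs_v pos by force+
    then have "?N' = ?N" "?T' = 2 * ?N" using N' T' by auto
    moreover have "J \<inter> {..<Suc m} = J \<inter> {..<m}" using down by (auto simp: less_Suc_eq)
    moreover have "m \<noteq> 0" using down assms(2) pos by (cases m) auto
    \<comment> \<open>By the second half of the induction hypothesis \<open>2 * ?N\<close> drops to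
      0 when \<open>m\<close> is a peak with \<open>m\<close> and \<open>m - 1\<close> outside
      \<open>J\<close>, and equals \<open>?T\<close> otherwise.\<close>
    ultimately show ?thesis using down IH PS by (auto split: if_splits)
  qed
qed

text \<open>Adjacent letters differ, so \<open>DesB m w \<subseteq> J\<close> is the same as strict
  ascents outside \<open>J\<close>.\<close>

lemma signings_perm:
  assumes "u \<in> perms m"
  shows "signings u m J = {w \<in> signed_perms m. (\<lambda>i. \<bar>w i\<bar>) = u \<and> DesB m w \<subseteq> J}"
proof -
  have "v \<in> signings u m J \<longleftrightarrow> DesB m v \<subseteq> J" if v: "v \<in> signed_perms m" "(\<lambda>i. \<bar>v i\<bar>) = u" for v
  proof -
    have "v i \<noteq> v (Suc i)" if "i < m" for i
      using signed_perms_adjacent[OF v(1) that] by auto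
    then have "DesB m v \<subseteq> J \<longleftrightarrow> (\<forall>i<m. i \<notin> J \<longrightarrow> v i < v (Suc i))"
      by (fastforce simp: DesB_def subset_eq dest: less_asym)
    moreover have "\<forall>i>m. v i = 0" using signed_perms_outside[OF v(1)] by auto
    ultimately show ?thesis using v(2) by (auto simp: signings_def)
  qed
  moreover have "v \<in> signed_perms m \<and> (\<lambda>i. \<bar>v i\<bar>) = u" if "v \<in> signings u m J" for v
  proof -
    have "\<bar>v i\<bar> = u i" for i
      using that perms_signed[OF assms, THEN signed_perms_outside, of i]
      by (cases "i \<le> m") (auto simp: signings_def)
    then show ?thesis using assms by (auto simp: signed_perms_iff_abs)
  qed
  ultimately show ?thesis by blast
qed

lemma finite_signed_fibre: "finite {w \<in> signed_perms m. (\<lambda>i. \<bar>w i\<bar>) = u}"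
proof (cases "u \<in> perms m")
  case True
  \<comment> \<open>\<open>J = UNIV\<close> drops all descent conditions and leaves the whole
    fibre.\<close>
  have "finite (signings u m UNIV)"
    using perms_abs[OF True] by (intro finite_signings) (metis abs_ge_zero)
  then show ?thesis by (simp add: signings_perm[OF True])
next
  case False
  then have "{w \<in> signed_perms m. (\<lambda>i. \<bar>w i\<bar>) = u} = {}"
    by (auto simp: signed_perms_iff_abs)
  then show ?thesis by (simp only: finite.emptyI)
qed

lemma forget_outside: "u \<notin> perms m \<Longrightarrow> forget m x u = 0"
proof -
  assume "u \<notin> perms m"
  then have "{w \<in> signed_perms m. (\<lambda>i. \<bar>w i\<bar>) = u} = {}"
    by (auto simp: signed_perms_iff_abs)
  then show ?thesis by (simp only: forget_def sum.empty)
qed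

lemma linear_forget: "linear_on UNIV (forget m)"
  by (simp add: linear_on_def forget_def sum.distrib sum_distrib_left)

lemma forget_XB:
  assumes "K \<subseteq> {0..<m}"
  shows "forget m (XB m K) =
    (\<lambda>u. if u \<in> perms m \<and> Peak m u \<subseteq> K \<union> Suc ` K then 2 ^ card K else 0)"
proof
  fix u
  show "forget m (XB m K) u =
    (if u \<in> perms m \<and> Peak m u \<subseteq> K \<union> Suc ` K then 2 ^ card K else 0)"
  proof (cases "u \<in> perms m")
    case False
    then show ?thesis by (simp add: forget_outside)
  next
    case u: True
    note us = perms_signed[OF u]
    have "forget m (XB m K) u = (\<Sum>w | w \<in> signed_perms m \<and> (\<lambda>i. \<bar>w i\<bar>) = u.
        if w \<in> {w. DesB m w \<subseteq> K} then 1 else 0)"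
      unfolding forget_def XB_def by (intro sum.cong) auto
    also have "\<dots> = of_nat (card (signings u m K))"
      unfolding signings_perm[OF u]
      by (subst sum.inter_restrict[OF finite_signed_fibre, symmetric])
        (auto intro!: arg_cong[where f = card])
    also have "card (signings u m K) =
      (if \<forall>i\<in>{1..<m}. u (i - 1) < u i \<and> u i > u (Suc i) \<longrightarrow> i \<in> K \<or> i - 1 \<in> K
       then 2 ^ card (K \<inter> {..<m}) else 0)"
    proof (intro conjunct1[OF card_signings_aux])
      show "0 \<le> u i" for i using u by (simp add: perms_def)
      show "u 0 = 0" using signed_perms_outside[OF us] by simp
      show "u i \<noteq> u (Suc i)" if "i < m" for i using signed_perms_adjacent[OF us that] by auto
      show "u i \<noteq> 0" if "i \<in> {1..m}" for i using signed_perms_nonzero[OF us that] .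
    qed
    also have "K \<inter> {..<m} = K" using assms by auto
    also have "(\<forall>i\<in>{1..<m}. u (i - 1) < u i \<and> u i > u (Suc i) \<longrightarrow> i \<in> K \<or> i - 1 \<in> K)
        \<longleftrightarrow> Peak m u \<subseteq> K \<union> Suc ` K"
    proof -
      have "i \<in> Suc ` K \<longleftrightarrow> i - 1 \<in> K" if "i \<in> {1..<m}" for i
        using that by (cases i) auto
      then show ?thesis by (auto simp: Peak_def)
    qed
    finally show ?thesis using u by simp
  qed
qed

section \<open>Peak sets\<close>

lemma finite_peak_sets: "finite (peak_sets m)"
  by (rule finite_subset[of _ "Pow {1..<m}"]) (auto simp: peak_sets_def)

lemma peak_sets_finite: "F \<in> peak_sets m \<Longrightarrow> finite F"
  by (auto simp: peak_sets_def intro: finite_subset)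

lemma Peak_in_peak_sets: "Peak m u \<in> peak_sets m"
  by (auto simp: Peak_def peak_sets_def)

lemma Peak_ring_in_peak_sets: "Peak m u - {1} \<in> {F \<in> peak_sets m. 1 \<notin> F}"
  by (auto simp: Peak_def peak_sets_def)

text \<open>Each element of \<open>G\<close> outside \<open>F\<close> is moved up by one into
  \<open>F\<close>. Nothing collides, as \<open>G\<close> has no consecutive elements, so the sum
  does not exceed that of \<open>F\<close>. It is strictly smaller because either some element
  moves, or \<open>G\<close> is a proper subset and misses a positive element of
  \<open>F\<close>.\<close>

lemma sum_less_of_subset_shift:
  assumes F: "F \<in> peak_sets m" and G: "G \<in> peak_sets m"
    and sub: "G \<subseteq> F \<union> (\<lambda>i. i - 1) ` F" and ne: "G \<noteq> F"
  shows "\<Sum>G < \<Sum>F"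
proof -
  have fin: "finite F" "finite G" using F G by (auto intro: peak_sets_finite)
  define h where "h g = (if g \<in> F then g else Suc g)" for g
  have pos: "f \<ge> 1" if "f \<in> F" for f using F that by (auto simp: peak_sets_def)
  have inj: "inj_on h G"
    using G by (auto simp: inj_on_def h_def peak_sets_def split: if_splits)
  have im: "h ` G \<subseteq> F"
  proof
    fix x assume "x \<in> h ` G"
    then obtain g where g: "g \<in> G" "x = h g" by auto
    then show "x \<in> F" using sub pos by (cases "g \<in> F") (force simp: h_def)+
  qed
  have sum_h: "\<Sum>(h ` G) = (\<Sum>g\<in>G. h g)" using inj by (simp add: sum.reindex)
  show ?thesis
  proof (cases "G \<subseteq> F")
    case True
    then obtain f where f: "f \<in> F" "f \<notin> G" using ne by auto
    have "\<Sum>G + f = \<Sum>(insert f G)" using f fin by simp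
    also have "\<dots> \<le> \<Sum>F" using f True fin by (intro sum_mono2) auto
    finally show ?thesis using pos[OF f(1)] by simp
  next
    case False
    then have "\<Sum>G < (\<Sum>g\<in>G. h g)"
      using fin by (intro sum_strict_mono_ex1) (auto simp: h_def)
    also have "\<dots> \<le> \<Sum>F" unfolding sum_h[symmetric] using fin im by (intro sum_mono2) auto
    finally show ?thesis .
  qed
qed

text \<open>Applied with \<open>h\<close> the peak set, with or without the element 1, this shows
  that functions depending on that statistic alone lie in the respective peak space.\<close>

lemma class_function_in_span:
  fixes g :: "'b \<Rightarrow> rat"
  assumes "finite B" "\<And>u. u \<in> S \<Longrightarrow> h u \<in> B"
  shows "(\<lambda>u. if u \<in> S then g (h u) else 0)
    \<in> qspan {\<lambda>u. if u \<in> S \<and> h u = F then 1 else 0 | F. F \<in> B}"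
proof -
  have "(\<lambda>u. if u \<in> S then g (h u) else 0)
      = (\<lambda>u. \<Sum>F\<in>B. g F * (if u \<in> S \<and> h u = F then 1 else 0))"
  proof
    fix u
    have "(\<Sum>F\<in>B. g F * (if u \<in> S \<and> h u = F then 1 else 0))
      = (\<Sum>F\<in>B. if h u = F then if u \<in> S then g F else 0 else 0)"
      by (intro sum.cong) auto
    then show "(if u \<in> S then g (h u) else 0)
        = (\<Sum>F\<in>B. g F * (if u \<in> S \<and> h u = F then 1 else 0))"
      using assms by (simp add: sum.delta)
  qed
  then show ?thesis by (simp only:) (intro qspan_sum qspan_base, blast)
qed

text \<open>Inversion of a unitriangular system: the function of \<open>F\<close> in the spanning
  set is the indicator of \<open>F\<close> plus indicators of other sets \<open>G\<close>, whose
  element sums are smaller by \<open>sum_less_of_subset_shift\<close>. The general \<open>B\<close>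
  and \<open>h\<close> cover all peaks and interior peaks at once.\<close>

lemma indicator_in_triangular_span:
  fixes h :: "'a \<Rightarrow> nat set"
  assumes B: "B \<subseteq> peak_sets m" and h: "\<And>u. u \<in> S \<Longrightarrow> h u \<in> B" and "F \<in> B"
  shows "(\<lambda>u. if u \<in> S \<and> h u = F then 1 else 0)
    \<in> qspan {\<lambda>u. if u \<in> S \<and> h u \<subseteq> F \<union> (\<lambda>i. i - 1) ` F then 1 else 0 | F. F \<in> B}"
    (is "?I F \<in> qspan ?T")
  using \<open>F \<in> B\<close>
proof (induction "\<Sum>F" arbitrary: F rule: less_induct)
  case less
  let ?Q = "\<lambda>u. if u \<in> S \<and> h u \<subseteq> F \<union> (\<lambda>i. i - 1) ` F then 1 else (0 :: rat)"
  define C where "C = {G \<in> B. G \<subseteq> F \<union> (\<lambda>i. i - 1) ` F} - {F}"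
  have "finite C"
    using finite_subset[OF B finite_peak_sets] by (simp add: C_def)
  have C: "?I G \<in> qspan ?T" if "G \<in> C" for G
    using that less B by (intro less.hyps sum_less_of_subset_shift[of F m]) (auto simp: C_def)
  have "?I F = (\<lambda>u. 1 * ?Q u + (- 1) * (\<Sum>G\<in>C. 1 * ?I G u))"
  proof
    fix u
    have "(\<Sum>G\<in>C. 1 * ?I G u) = (\<Sum>G\<in>C. if h u = G then if u \<in> S then 1 else 0 else 0)"
      by (intro sum.cong) auto
    also have "\<dots> = (if h u \<in> C \<and> u \<in> S then 1 else 0)"
      using \<open>finite C\<close> by (simp add: sum.delta)
    finally show "?I F u = 1 * ?Q u + (- 1) * (\<Sum>G\<in>C. 1 * ?I G u)"
      using h by (auto simp: C_def)
  qed
  moreover have "?Q \<in> qspan ?T" using less.prems by (intro qspan_base) auto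
  moreover have "(\<lambda>u. \<Sum>G\<in>C. 1 * ?I G u) \<in> qspan ?T" using C by (intro qspan_sum) auto
  ultimately show ?case by (simp only: qspan_lincomb)
qed

lemma class_function_in_PP:
  "(\<lambda>u. if u \<in> perms m then g (Peak m u) else 0) \<in> PP m"
  unfolding PP_def PF_def by (intro class_function_in_span finite_peak_sets Peak_in_peak_sets)

lemma class_function_in_PPring:
  "(\<lambda>u. if u \<in> perms m then g (Peak m u - {1}) else 0) \<in> PPring m"
proof -
  have "finite {F \<in> peak_sets m. 1 \<notin> F}" using finite_peak_sets by simp
  from class_function_in_span[OF this, of "perms m" "\<lambda>u. Peak m u - {1}"]
  show ?thesis unfolding PPring_def PFring_def using Peak_ring_in_peak_sets by simp
qed

text \<open>Up to a scalar, \<open>peak_below m F\<close> is the image of \<open>X\<^bsub>F - 1\<^esub>\<close> under \<open>\<phi>\<close>.\<close>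

definition peak_below :: "nat \<Rightarrow> nat set \<Rightarrow> (nat \<Rightarrow> int) \<Rightarrow> rat" where
  "peak_below m F = (\<lambda>u. if u \<in> perms m \<and> Peak m u \<subseteq> F \<union> (\<lambda>i. i - 1) ` F then 1 else 0)"

text \<open>For \<open>F\<close> in \<open>peak_sets m\<close> without 1 and
  \<open>m \<ge> 2\<close>, this is up to a scalar the image of \<open>XD m J\<close>, where
  \<open>J\<close> is \<open>F - 1\<close> with the label 1' (encoded as 0) adjoined.\<close>

definition peak_below_ring :: "nat \<Rightarrow> nat set \<Rightarrow> (nat \<Rightarrow> int) \<Rightarrow> rat" where
  "peak_below_ring m F =
    (\<lambda>u. if u \<in> perms m \<and> Peak m u - {1} \<subseteq> F \<union> (\<lambda>i. i - 1) ` F then 1 else 0)"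

lemma PP_subset_peak_below: "PP m \<subseteq> qspan {peak_below m F | F. F \<in> peak_sets m}"
  unfolding PP_def
proof (rule qspan_subset, safe)
  fix F assume "F \<in> peak_sets m"
  then show "PF m F \<in> qspan {peak_below m F | F. F \<in> peak_sets m}"
    unfolding PF_def peak_below_def
    by (intro indicator_in_triangular_span[of _ m] Peak_in_peak_sets order_refl)
qed

lemma PPring_subset_peak_below_ring:
  "PPring m \<subseteq> qspan {peak_below_ring m F | F. F \<in> peak_sets m \<and> 1 \<notin> F}"
  unfolding PPring_def
proof (rule qspan_subset, safe)
  fix F assume "F \<in> peak_sets m" "1 \<notin> F"
  then show "PFring m F \<in> qspan {peak_below_ring m F | F. F \<in> peak_sets m \<and> 1 \<notin> F}"
    unfolding PFring_def peak_below_ring_def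
    using indicator_in_triangular_span[of "{F \<in> peak_sets m. 1 \<notin> F}" m "perms m" "\<lambda>u. Peak m u - {1}" F]
      Peak_ring_in_peak_sets by auto
qed

text \<open>For a peak set \<open>F\<close>, the product of the commuting adjacent transpositions of
  \<open>i\<close> and \<open>i + 1\<close> for \<open>i\<close> in \<open>F\<close>; it serves as a
  representative of the permutations with peak set \<open>F\<close>.\<close>

definition peak_perm :: "nat \<Rightarrow> nat set \<Rightarrow> nat \<Rightarrow> int" where
  "peak_perm m F i = (if i \<notin> {1..m} then 0 else if i \<in> F then int i + 1
     else if i - 1 \<in> F then int i - 1 else int i)"

lemma peak_perm:
  assumes F: "F \<in> peak_sets m"
  shows "peak_perm m F \<in> perms m" "Peak m (peak_perm m F) = F"
proof -
  have *: "1 \<le> i" "i < m" "i - 1 \<notin> F" "Suc i \<notin> F" if "i \<in> F" for i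
  proof -
    show "1 \<le> i" "i < m" "Suc i \<notin> F" using F that by (auto simp: peak_sets_def)
    then show "i - 1 \<notin> F" using F that by (cases i) (auto simp: peak_sets_def)
  qed
  have less: "peak_perm m F i \<noteq> peak_perm m F j" if "i \<in> {1..m}" "j \<in> {1..m}" "i < j" for i j
  proof -
    \<comment> \<open>Values differ from their positions by at most one, so only positions at
      distance one or two could clash; there the absence of consecutive elements in \<open>F\<close>
      decides.\<close>
    consider "j = Suc i" | "j = Suc (Suc i)" | "j > Suc (Suc i)" using \<open>i < j\<close> by linarith
    then show ?thesis
      using that *[of i] by cases (auto simp: peak_perm_def)
  qed
  have abs_pp: "\<bar>peak_perm m F i\<bar> = peak_perm m F i" for i
    by (auto simp: peak_perm_def)
  have "peak_perm m F \<in> signed_perms m"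
  proof (rule signed_permsI)
    fix i assume "i \<in> {1..m}"
    then show "\<bar>peak_perm m F i\<bar> \<in> {1..int m}"
      using *[of i] *[of "i - 1"] by (auto simp: peak_perm_def)
  next
    fix i j
    assume "i \<in> {1..m}" "j \<in> {1..m}" "\<bar>peak_perm m F i\<bar> = \<bar>peak_perm m F j\<bar>"
    then show "i = j"
      using less[of i j] less[of j i] abs_pp by (metis linorder_neqE_nat)
  qed (auto simp: peak_perm_def)
  then show "peak_perm m F \<in> perms m"
    by (auto simp: perms_def peak_perm_def)
  have "i \<in> Peak m (peak_perm m F) \<longleftrightarrow> i \<in> F" if "i \<in> {1..<m}" for i
  proof -
    have "peak_perm m F i > peak_perm m F (Suc i) \<longleftrightarrow> i \<in> F"
      using that *[of i] *[of "i - 1"] by (auto simp: peak_perm_def)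
    moreover have "peak_perm m F (i - 1) < peak_perm m F i" if "i \<in> F"
      using that *[of i] *[of "i - 1"] *[of "i - 2"] by (auto simp: peak_perm_def)
    ultimately show ?thesis using that by (auto simp: Peak_def)
  qed
  then show "Peak m (peak_perm m F) = F"
    using * by (auto simp: Peak_def)
qed

section \<open>The image of type B under forgetting signs\<close>

lemma qspan_scaled_image:
  assumes "x \<in> S" "forget m x = (\<lambda>u. c * y u)" "c \<noteq> 0"
  shows "y \<in> forget m ` qspan S"
proof -
  have "y = (\<lambda>u. inverse c * forget m x u)" using assms(2,3) by (simp add: fun_eq_iff)
  also have "\<dots> = forget m (\<lambda>w. inverse c * x w)" by (simp add: forget_def sum_distrib_left)
  finally show ?thesis using assms(1) by (blast intro: qspan_scale qspan_base)
qed

lemma peak_set_pred: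
  assumes "F \<in> peak_sets n"
  shows "(\<lambda>i. i - 1) ` F \<subseteq> {0..<n}" "Suc ` (\<lambda>i. i - 1) ` F = F"
  using assms by (force simp: peak_sets_def)+

lemma forget_SigmaB: "forget m ` SigmaB m = PP m"
proof
  show "forget m ` SigmaB m \<subseteq> PP m"
    unfolding SigmaB_def PP_def
  proof (rule linear_image_qspan_subset[OF linear_forget], fold PP_def, safe)
    fix K assume "K \<subseteq> {0..<m}"
    then have "forget m (XB m K) = (\<lambda>u. if u \<in> perms m
        then if Peak m u \<subseteq> K \<union> Suc ` K then 2 ^ card K else 0 else 0)"
      by (auto simp: forget_XB)
    then show "forget m (XB m K) \<in> PP m"
      using class_function_in_PP[of m "\<lambda>G. if G \<subseteq> K \<union> Suc ` K then 2 ^ card K else 0"] by simp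
  qed
  have "peak_below m F \<in> forget m ` SigmaB m" if F: "F \<in> peak_sets m" for F
  proof -
    let ?K = "(\<lambda>i. i - 1) ` F"
    note K = peak_set_pred[OF F]
    have "forget m (XB m ?K) = (\<lambda>u. 2 ^ card ?K * peak_below m F u)"
      unfolding forget_XB[OF K(1)] K(2) by (auto simp: peak_below_def fun_eq_iff)
    moreover have "XB m ?K \<in> {XB m J | J. J \<subseteq> {0..<m}}" using K(1) by blast
    moreover have "(2 :: rat) ^ card ?K \<noteq> 0" by simp
    ultimately show ?thesis unfolding SigmaB_def by (intro qspan_scaled_image)
  qed
  then show "PP m \<subseteq> forget m ` SigmaB m"
    using PP_subset_peak_below[of m]
      qspan_subset_linear_image[OF linear_forget, of "{peak_below m F | F. F \<in> peak_sets m}" m]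
    unfolding SigmaB_def by blast
qed

section \<open>Forgetting signs in type D\<close>

text \<open>Negating the first letter exchanges \<open>D\<^sub>n\<close> and its complement in \<open>B\<^sub>n\<close>.\<close>

definition flip_first :: "(nat \<Rightarrow> int) \<Rightarrow> nat \<Rightarrow> int" where
  "flip_first w i = (if i = 1 then - w i else w i)"

lemma abs_flip_first: "\<bar>flip_first w i\<bar> = \<bar>w i\<bar>"
  by (simp add: flip_first_def)

lemma flip_first_flip_first: "flip_first (flip_first w) = w"
  by (auto simp: flip_first_def)

lemma signed_perms_flip_first: "flip_first w \<in> signed_perms n \<longleftrightarrow> w \<in> signed_perms n"
  by (simp add: signed_perms_iff_abs abs_flip_first)

lemma sign_prod_flip_first:
  assumes "n \<ge> 1"
  shows "sign_prod n (flip_first w) = - sign_prod n w"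
proof -
  have "(\<Prod>i\<in>{1..n} - {1}. sgn (flip_first w i)) = (\<Prod>i\<in>{1..n} - {1}. sgn (w i))"
    by (intro prod.cong) (auto simp: flip_first_def)
  moreover have "1 \<in> {1..n}" using assms by simp
  ultimately show ?thesis
    using prod.remove[of "{1..n}" 1 "\<lambda>i. sgn (flip_first w i)"]
      prod.remove[of "{1..n}" 1 "\<lambda>i. sgn (w i)"]
    by (simp add: sign_prod_def flip_first_def sgn_minus)
qed

text \<open>Every fibre splits into pairs \<open>w\<close>, \<open>flip_first w\<close>, and exactly
  one member of each pair lies in \<open>Dperms n\<close>.\<close>

lemma forget_fold:
  assumes "n \<ge> 1"
  shows "forget n y u =
    (\<Sum>w | w \<in> Dperms n \<and> (\<lambda>i. \<bar>w i\<bar>) = u. y w + y (flip_first w))"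
proof -
  let ?D = "{w \<in> Dperms n. (\<lambda>i. \<bar>w i\<bar>) = u}"
  let ?E = "{w \<in> signed_perms n. (\<lambda>i. \<bar>w i\<bar>) = u}"
  have "?E = ?D \<union> flip_first ` ?D"
  proof (intro equalityI subsetI)
    fix w assume w: "w \<in> ?E"
    show "w \<in> ?D \<union> flip_first ` ?D"
    proof (cases "sign_prod n w = 1")
      case True
      then show ?thesis using w by (simp add: Dperms_iff_sign_prod)
    next
      case False
      then have "sign_prod n (flip_first w) = 1"
        using sign_prod_cases[of w n] sign_prod_flip_first[OF assms, of w] w by auto
      then have "flip_first w \<in> ?D"
        using w by (simp add: Dperms_iff_sign_prod signed_perms_flip_first abs_flip_first)
      then show ?thesis
        by (intro UnI2 image_eqI[of _ _ "flip_first w"]) (simp_all only: flip_first_flip_first)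
    qed
  next
    fix w assume "w \<in> ?D \<union> flip_first ` ?D"
    then show "w \<in> ?E"
      by (auto simp: Dperms_iff_sign_prod signed_perms_flip_first abs_flip_first)
  qed
  moreover have "?D \<inter> flip_first ` ?D = {}"
    using sign_prod_flip_first[OF assms] by (auto simp: Dperms_iff_sign_prod)
  moreover have "inj_on flip_first ?D"
    by (rule inj_on_inverseI[of _ flip_first]) (rule flip_first_flip_first)
  moreover have "finite ?D"
    by (rule finite_subset[OF _ finite_signed_fibre[of n u]]) (auto simp: Dperms_def)
  ultimately show ?thesis
    unfolding forget_def by (simp add: sum.union_disjoint sum.reindex sum.distrib)
qed

section \<open>Comparison of types B and D\<close>

lemma forget_XD:
  "forget n (XD n J) u = (\<Sum>w | w \<in> Dperms n \<and> (\<lambda>i. \<bar>w i\<bar>) = u. of_bool (DesD n w \<subseteq> J))"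
  unfolding forget_def
  by (rule sum.mono_neutral_cong_right[OF finite_signed_fibre])
    (auto simp: Dperms_def XD_def)

text \<open>Both types agree at positions from 2 on, so the comparison needs only the first two
  labels separated out.\<close>

lemma DesB_subset_iff:
  assumes "w \<in> signed_perms n" "n \<ge> 2"
  shows "DesB n w \<subseteq> K \<longleftrightarrow> (w 1 < 0 \<longrightarrow> 0 \<in> K) \<and> (w 1 > w 2 \<longrightarrow> 1 \<in> K) \<and>
    (\<forall>i\<in>{2..<n}. w i > w (Suc i) \<longrightarrow> i \<in> K)"
proof -
  have "DesB n w \<subseteq> K \<longleftrightarrow> (\<forall>i\<in>{0..<n}. w i > w (Suc i) \<longrightarrow> i \<in> K)"
    by (auto simp: DesB_def)
  also have "{0..<n} = insert 0 (insert 1 {2..<n})" using assms(2) by auto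
  finally show ?thesis
    using signed_perms_outside[OF assms(1), of 0] by (simp add: numeral_2_eq_2)
qed

lemma DesD_subset_iff:
  assumes "n \<ge> 2"
  shows "DesD n w \<subseteq> J \<longleftrightarrow> (- w 1 > w 2 \<longrightarrow> 0 \<in> J) \<and> (w 1 > w 2 \<longrightarrow> 1 \<in> J) \<and>
    (\<forall>i\<in>{2..<n}. w i > w (Suc i) \<longrightarrow> i \<in> J)"
proof -
  have "DesD n w \<subseteq> J \<longleftrightarrow> (- w 1 > w 2 \<longrightarrow> 0 \<in> J) \<and>
      (\<forall>i\<in>{1..<n}. w i > w (Suc i) \<longrightarrow> i \<in> J)"
    by (auto simp: DesD_def)
  also have "{1..<n} = insert 1 {2..<n}" using assms by auto
  finally show ?thesis by (simp add: numeral_2_eq_2)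
qed

lemma first_letters:
  assumes "w \<in> signed_perms n" "n \<ge> 2"
  shows "w 1 \<noteq> 0" "w 2 \<noteq> 0" "\<bar>w 1\<bar> \<noteq> \<bar>w 2\<bar>"
  using signed_perms_nonzero[OF assms(1), of 1] signed_perms_nonzero[OF assms(1), of 2]
    signed_perms_adjacent[OF assms(1), of 1] assms(2) by (auto simp: numeral_2_eq_2)

text \<open>Involution of \<open>D\<^sub>n\<close> interchanging the labels \<open>1'\<close> and \<open>1\<close>: negate the first letter
  and the letter \<open>\<plusminus>1\<close>.  The sign of the latter is irrelevant for all comparisons.\<close>

definition swap_labels :: "(nat \<Rightarrow> int) \<Rightarrow> nat \<Rightarrow> int" where
  "swap_labels w i = (if i = 1 then - 1 else 1) * (if \<bar>w i\<bar> = 1 then - 1 else 1) * w i"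

lemma abs_swap_labels: "(\<lambda>i. \<bar>swap_labels w i\<bar>) = (\<lambda>i. \<bar>w i\<bar>)"
  by (auto simp: swap_labels_def)

lemma swap_labels_involution: "swap_labels (swap_labels w) = w"
  by (auto simp: swap_labels_def)

text \<open>Two sign changes preserve parity; if the first letter is itself 1 or -1, they
  cancel.\<close>

lemma swap_labels_Dperms:
  assumes "w \<in> Dperms n" "n \<ge> 2"
  shows "swap_labels w \<in> Dperms n"
proof -
  have w: "w \<in> signed_perms n" "sign_prod n w = 1"
    using assms by (auto simp: Dperms_iff_sign_prod)
  have "(1 :: nat) \<in> (\<lambda>i. nat \<bar>w i\<bar>) ` {1..n}"
    using w(1) assms(2) by (simp add: signed_perms_def bij_betw_def)
  then obtain j where j: "j \<in> {1..n}" "\<bar>w j\<bar> = 1" by auto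
  have "\<bar>w i\<bar> = 1 \<longleftrightarrow> i = j" if "i \<in> {1..n}" for i
    using signed_perms_inj[OF w(1) that j(1)] j(2) by metis
  then have "(\<Prod>i\<in>{1..n}. if \<bar>w i\<bar> = 1 then - 1 else 1)
      = (\<Prod>i\<in>{1..n}. if i = j then - 1 else (1 :: int))"
    by (intro prod.cong) simp_all
  also have "\<dots> = - 1" using j by (simp add: prod.delta)
  finally have one: "(\<Prod>i\<in>{1..n}. if \<bar>w i\<bar> = 1 then - 1 else (1 :: int)) = - 1" .
  have "sign_prod n (swap_labels w) = (\<Prod>i\<in>{1..n}. (if i = 1 then - 1 else 1)
      * (if \<bar>w i\<bar> = 1 then - 1 else 1) * sgn (w i))"
    unfolding sign_prod_def by (intro prod.cong) (auto simp: swap_labels_def sgn_mult)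
  also have "\<dots> = 1"
    using one w(2) assms(2) by (simp add: prod.distrib prod.delta sign_prod_def)
  finally show ?thesis
    using w(1) by (simp add: Dperms_iff_sign_prod signed_perms_iff_abs abs_swap_labels)
qed

lemma swap_labels_DesD:
  assumes "w \<in> signed_perms n" "n \<ge> 2" "0 \<notin> J" "1 \<in> J"
  shows "DesD n (swap_labels w) \<subseteq> J \<longleftrightarrow> DesD n w \<subseteq> insert 0 (J - {1})"
proof -
  let ?c = "\<lambda>a :: int. (if \<bar>a\<bar> = 1 then - 1 else 1) * a"
  \<comment> \<open>If one of the letters has absolute value 1, the other has absolute value at
    least 2, and the sign of the latter decides the comparison.\<close>
  have cmp: "?c a > ?c b \<longleftrightarrow> a > b" "- ?c a > ?c b \<longleftrightarrow> - a > b"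
    if "a \<noteq> 0" "b \<noteq> 0" "\<bar>a\<bar> \<noteq> \<bar>b\<bar>" for a b :: int
    using that by (auto split: if_splits)
  have s: "swap_labels w 1 = - ?c (w 1)" "\<And>i. i \<ge> 2 \<Longrightarrow> swap_labels w i = ?c (w i)"
    by (auto simp: swap_labels_def)
  have "swap_labels w i > swap_labels w (Suc i) \<longleftrightarrow> w i > w (Suc i)" if "i \<in> {2..<n}" for i
  proof -
    have "2 \<le> i" "2 \<le> Suc i" using that by auto
    from s(2)[OF this(1)] s(2)[OF this(2)] show ?thesis
      using that cmp(1)[of "w i" "w (Suc i)"] signed_perms_nonzero[OF assms(1), of i]
        signed_perms_nonzero[OF assms(1), of "Suc i"] signed_perms_adjacent[OF assms(1), of i]
      by auto
  qed
  moreover have "swap_labels w 1 > swap_labels w 2 \<longleftrightarrow> - w 1 > w 2"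
    "- swap_labels w 1 > swap_labels w 2 \<longleftrightarrow> w 1 > w 2"
    using cmp[OF first_letters[OF assms(1,2)]] s(1) s(2)[of 2] by simp_all
  ultimately show ?thesis
    unfolding DesD_subset_iff[OF assms(2)] using assms(3,4) by auto
qed

text \<open>\<open>swap_labels\<close> permutes the elements of \<open>Dperms n\<close> in each
  fibre and exchanges the two descent conditions.\<close>

lemma forget_XD_swap:
  assumes "n \<ge> 2" "0 \<notin> J" "1 \<in> J"
  shows "forget n (XD n J) = forget n (XD n (insert 0 (J - {1})))"
proof
  fix u
  have "DesD n (swap_labels w) \<subseteq> insert 0 (J - {1}) \<longleftrightarrow> DesD n w \<subseteq> J" if "w \<in> Dperms n" for w
  proof -
    have "swap_labels w \<in> signed_perms n"
      using swap_labels_Dperms[OF that assms(1)] by (simp add: Dperms_def)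
    from swap_labels_DesD[OF this assms] show ?thesis by (simp add: swap_labels_involution)
  qed
  then show "forget n (XD n J) u = forget n (XD n (insert 0 (J - {1}))) u"
    unfolding forget_XD using swap_labels_Dperms[OF _ assms(1)]
    by (intro sum.reindex_bij_witness[of _ swap_labels swap_labels])
      (simp_all add: swap_labels_involution abs_swap_labels)
qed

text \<open>The type D condition at the front is \<open>\<bar>w 1\<bar> < w 2\<close>. Under it
  exactly one of \<open>w\<close> and \<open>flip_first w\<close> has a positive first letter, as
  type B requires.\<close>

lemma forget_XB_eq_XD:
  assumes "n \<ge> 2" "0 \<notin> K" "1 \<notin> K"
  shows "forget n (XB n K) = forget n (XD n K)"
proof
  fix u
  have "XB n K w + XB n K (flip_first w) = of_bool (DesD n w \<subseteq> K)" if "w \<in> Dperms n" for w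
  proof -
    have w: "w \<in> signed_perms n" using that by (simp add: Dperms_def)
    have w': "flip_first w \<in> signed_perms n" using w by (simp only: signed_perms_flip_first)
    let ?R = "\<forall>i\<in>{2..<n}. w i > w (Suc i) \<longrightarrow> i \<in> K"
    have "DesB n w \<subseteq> K \<longleftrightarrow> w 1 > 0 \<and> w 1 < w 2 \<and> ?R"
      "DesB n (flip_first w) \<subseteq> K \<longleftrightarrow> w 1 < 0 \<and> - w 1 < w 2 \<and> ?R"
      "DesD n w \<subseteq> K \<longleftrightarrow> - w 1 < w 2 \<and> w 1 < w 2 \<and> ?R"
      using assms(2,3) first_letters[OF w assms(1)]
      by (auto simp: DesB_subset_iff[OF w assms(1)] DesB_subset_iff[OF w' assms(1)]
        DesD_subset_iff[OF assms(1)] flip_first_def)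
    then show ?thesis using w w' first_letters(1)[OF w assms(1)] by (auto simp: XB_def)
  qed
  then show "forget n (XB n K) u = forget n (XD n K) u"
    using assms(1) by (simp add: forget_fold forget_XD)
qed

text \<open>With 0 in \<open>K\<close> the sign of the first letter is free in type B. Then
  \<open>w\<close> satisfies the type D condition for \<open>K\<close>, and
  \<open>flip_first w\<close> the one with the roles of 1' and 1 exchanged; both have the same image
  by \<open>forget_XD_swap\<close>.\<close>

lemma forget_XB_eq_XD_zero:
  assumes "n \<ge> 2" "0 \<in> K"
  shows "forget n (XB n K) = (\<lambda>u. 2 * forget n (XD n K) u)"
proof
  fix u
  let ?K = "insert 1 (K - {0})"
  have "XB n K w + XB n K (flip_first w)
      = of_bool (DesD n w \<subseteq> K) + of_bool (DesD n w \<subseteq> (if 1 \<in> K then K else ?K))"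
    if "w \<in> Dperms n" for w
  proof -
    have w: "w \<in> signed_perms n" using that by (simp add: Dperms_def)
    have w': "flip_first w \<in> signed_perms n" using w by (simp only: signed_perms_flip_first)
    let ?R = "\<forall>i\<in>{2..<n}. w i > w (Suc i) \<longrightarrow> i \<in> K"
    have "DesB n w \<subseteq> K \<longleftrightarrow> (w 1 > w 2 \<longrightarrow> 1 \<in> K) \<and> ?R"
      "DesB n (flip_first w) \<subseteq> K \<longleftrightarrow> (- w 1 > w 2 \<longrightarrow> 1 \<in> K) \<and> ?R"
      "DesD n w \<subseteq> K \<longleftrightarrow> (w 1 > w 2 \<longrightarrow> 1 \<in> K) \<and> ?R"
      "DesD n w \<subseteq> ?K \<longleftrightarrow> \<not> - w 1 > w 2 \<and> ?R"
      using assms(2)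
      by (auto simp: DesB_subset_iff[OF w assms(1)] DesB_subset_iff[OF w' assms(1)]
        DesD_subset_iff[OF assms(1)] flip_first_def)
    then show ?thesis using w w' first_letters(1)[OF w assms(1)] by (auto simp: XB_def)
  qed
  then have "forget n (XB n K) u
      = forget n (XD n K) u + forget n (XD n (if 1 \<in> K then K else ?K)) u"
    using assms(1) by (simp add: forget_fold forget_XD sum.distrib)
  also have "forget n (XD n (if 1 \<in> K then K else ?K)) = forget n (XD n K)"
    using forget_XD_swap[OF assms(1), of ?K] assms(2) by (auto intro!: arg_cong[where f = "XD n"]
      arg_cong[where f = "forget n"])
  finally show "forget n (XB n K) u = 2 * forget n (XD n K) u" by simp
qed

lemma forget_XD_zero:
  assumes "n \<ge> 2" "J \<subseteq> {0..<n}" "0 \<in> J"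
  shows "forget n (XD n J) =
    (\<lambda>u. if u \<in> perms n \<and> Peak n u - {1} \<subseteq> J \<union> Suc ` J then 2 ^ card J / 2 else 0)"
proof
  fix u
  have "Peak n u - {1} \<subseteq> J \<union> Suc ` J \<longleftrightarrow> Peak n u \<subseteq> J \<union> Suc ` J"
    using assms(3) by auto
  moreover have "forget n (XB n J) u = 2 * forget n (XD n J) u"
    using forget_XB_eq_XD_zero[OF assms(1,3)] by simp
  ultimately show "forget n (XD n J) u
    = (if u \<in> perms n \<and> Peak n u - {1} \<subseteq> J \<union> Suc ` J then 2 ^ card J / 2 else 0)"
    by (simp add: forget_XB[OF assms(2)] split: if_splits)
qed

section \<open>Images of the ideal and of type D under forgetting signs\<close>

lemma peak_below_ring_image:
  assumes "n \<ge> 2" "F \<in> peak_sets n" "1 \<notin> F"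
  shows "peak_below_ring n F \<in> forget n ` Iideal n"
proof -
  \<comment> \<open>The added 0 puts \<open>XD n ?J\<close> into the ideal and frees position 1;
    position 0 itself is never a peak.\<close>
  let ?J = "insert 0 ((\<lambda>i. i - 1) ` F)"
  have "?J \<subseteq> {0..<n}" using peak_set_pred(1)[OF assms(2)] assms(1) by simp
  moreover have "?J \<union> Suc ` ?J = insert 0 (insert 1 (F \<union> (\<lambda>i. i - 1) ` F))"
    using peak_set_pred(2)[OF assms(2)] by auto
  moreover have "0 \<notin> Peak n u" for u by (simp add: Peak_def)
  ultimately have "forget n (XD n ?J) = (\<lambda>u. 2 ^ card ?J / 2 * peak_below_ring n F u)"
    using assms(1) by (subst forget_XD_zero) (auto simp: peak_below_ring_def fun_eq_iff)
  moreover have "XD n ?J \<in> {XD n J | J. J \<subseteq> {0..<n} \<and> (0 \<in> J \<or> 1 \<in> J)}"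
    using \<open>?J \<subseteq> {0..<n}\<close> by blast
  moreover have "(2 :: rat) ^ card ?J / 2 \<noteq> 0" by simp
  ultimately show ?thesis unfolding Iideal_def by (intro qspan_scaled_image)
qed

lemma forget_Iideal:
  assumes "n \<ge> 2"
  shows "forget n ` Iideal n = PPring n"
proof
  have zero: "forget n (XD n J) \<in> PPring n" if "J \<subseteq> {0..<n}" "0 \<in> J" for J
  proof -
    have "forget n (XD n J) = (\<lambda>u. if u \<in> perms n
        then if Peak n u - {1} \<subseteq> J \<union> Suc ` J then 2 ^ card J / 2 else 0 else 0)"
      unfolding forget_XD_zero[OF assms that] by auto
    then show ?thesis
      using class_function_in_PPring[of n "\<lambda>G. if G \<subseteq> J \<union> Suc ` J then 2 ^ card J / 2 else 0"] by simp
  qed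
  show "forget n ` Iideal n \<subseteq> PPring n"
    unfolding Iideal_def PPring_def
  proof (rule linear_image_qspan_subset[OF linear_forget], fold PPring_def)
    fix x assume "x \<in> {XD n J | J. J \<subseteq> {0..<n} \<and> (0 \<in> J \<or> 1 \<in> J)}"
    then obtain J where J: "x = XD n J" "J \<subseteq> {0..<n}" "0 \<in> J \<or> 1 \<in> J" by blast
    show "forget n x \<in> PPring n"
    proof (cases "0 \<in> J")
      case True
      then show ?thesis using J zero by simp
    next
      \<comment> \<open>Only the label 1 is present, and exchanging it for 1' leaves the image
        unchanged.\<close>
      case False
      then show ?thesis
        using J assms zero[of "insert 0 (J - {1})"] forget_XD_swap[OF assms, of J] by auto
    qed
  qed
  show "PPring n \<subseteq> forget n ` Iideal n"
    using PPring_subset_peak_below_ring[of n]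
      qspan_subset_linear_image[OF linear_forget,
        of "{peak_below_ring n F | F. F \<in> peak_sets n \<and> 1 \<notin> F}" n]
      peak_below_ring_image[OF assms]
    unfolding Iideal_def by blast
qed

lemma Iideal_subset_SigmaD: "Iideal n \<subseteq> SigmaD n"
  unfolding Iideal_def SigmaD_def by (rule qspan_subset) (auto intro: qspan_base)

lemma PPring_subset_PP: "PPring n \<subseteq> PP n"
  unfolding PPring_def PP_def
proof (rule qspan_subset, fold PP_def, safe)
  fix F
  from class_function_in_PP[of n "\<lambda>G. if G - {1} = F then 1 else 0"]
  show "PFring n F \<in> PP n"
    by (simp add: PFring_def if_if_eq_conj)
qed

lemma forget_SigmaD:
  assumes "n \<ge> 2"
  shows "forget n ` SigmaD n = PP n"
proof
  show "forget n ` SigmaD n \<subseteq> PP n"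
    unfolding SigmaD_def PP_def
  proof (rule linear_image_qspan_subset[OF linear_forget], fold PP_def)
    fix x assume "x \<in> {XD n J | J. J \<subseteq> {0..<n}}"
    then obtain J where J: "x = XD n J" "J \<subseteq> {0..<n}" by blast
    show "forget n x \<in> PP n"
    proof (cases "0 \<in> J \<or> 1 \<in> J")
      case True
      then have "x \<in> Iideal n" unfolding Iideal_def using J by (auto intro: qspan_base)
      then show ?thesis using forget_Iideal[OF assms] PPring_subset_PP[of n] by blast
    next
      case False
      then have "forget n x = forget n (XB n J)"
        using forget_XB_eq_XD[OF assms] J by auto
      moreover have "XB n J \<in> SigmaB n" unfolding SigmaB_def using J by (auto intro: qspan_base)
      ultimately show ?thesis using forget_SigmaB[of n] by auto
    qed
  qed
  have "peak_below n F \<in> forget n ` SigmaD n" if F: "F \<in> peak_sets n" for F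
  proof -
    let ?J = "(\<lambda>i. i - 1) ` F"
    note J = peak_set_pred[OF F]
    have B: "forget n (XB n ?J) = (\<lambda>u. 2 ^ card ?J * peak_below n F u)"
      unfolding forget_XB[OF J(1)] J(2) by (auto simp: peak_below_def fun_eq_iff)
    have in_gen: "XD n ?J \<in> {XD n J | J. J \<subseteq> {0..<n}}" using J(1) by blast
    have "0 \<notin> F" using F by (auto simp: peak_sets_def)
    \<comment> \<open>\<open>?J\<close> contains 0 iff \<open>1 \<in> F\<close>, and 1 iff
      \<open>2 \<in> F\<close>. In the first case the image is half of the type B image. In the
      second a peak at 1 is allowed anyway, so the interior version suffices. In the third the two
      types have equal images.\<close>
    consider "1 \<in> F" | "1 \<notin> F" "2 \<in> F" | "1 \<notin> F" "2 \<notin> F" by blast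
    then show ?thesis
    proof cases
      case 1
      then have "0 \<in> ?J" by force
      from forget_XB_eq_XD_zero[OF assms this]
      have "forget n (XD n ?J) = (\<lambda>u. 2 ^ card ?J / 2 * peak_below n F u)"
        unfolding B by (simp add: fun_eq_iff)
      from qspan_scaled_image[OF in_gen this] show ?thesis unfolding SigmaD_def by simp
    next
      case 2
      have "1 \<in> ?J" using 2 by force
      then have "A \<subseteq> F \<union> ?J \<longleftrightarrow> A - {1} \<subseteq> F \<union> ?J" for A by blast
      then have "peak_below n F = peak_below_ring n F"
        by (simp only: peak_below_def peak_below_ring_def)
      then show ?thesis
        using peak_below_ring_image[OF assms F 2(1)] Iideal_subset_SigmaD by auto
    next
      case 3
      have "i - 1 \<noteq> 0 \<and> i - 1 \<noteq> 1" if "i \<in> F" for i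
      proof -
        have "i \<noteq> 0" "i \<noteq> 1" "i \<noteq> 2" using 3 \<open>0 \<notin> F\<close> that by metis+
        then show ?thesis by linarith
      qed
      then have "0 \<notin> ?J" "1 \<notin> ?J" by force+
      from forget_XB_eq_XD[OF assms this]
      have "forget n (XD n ?J) = (\<lambda>u. 2 ^ card ?J * peak_below n F u)"
        unfolding B by simp
      from qspan_scaled_image[OF in_gen this] show ?thesis unfolding SigmaD_def by simp
    qed
  qed
  then show "PP n \<subseteq> forget n ` SigmaD n"
    using PP_subset_peak_below[of n]
      qspan_subset_linear_image[OF linear_forget, of "{peak_below n F | F. F \<in> peak_sets n}" n]
    unfolding SigmaD_def by blast
qed

section \<open>The maps \<open>\<gamma>\<close> and \<open>\<pi>\<close>\<close>

text \<open>Truncated subtraction reads \<open>v 0\<close> at position 0, so \<open>v 0 = 0\<close>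
  carries over to the prolongation.\<close>

definition attach :: "int \<Rightarrow> int \<Rightarrow> (nat \<Rightarrow> int) \<Rightarrow> nat \<Rightarrow> int" where
  "attach a b v i =
    (if i = 1 then a else if i = 2 then b else v (i - 2) + 2 * sgn (v (i - 2)))"

text \<open>The value at 0 is set separately, since the formula would read the second prepended
  letter there.\<close>

definition detach :: "(nat \<Rightarrow> int) \<Rightarrow> nat \<Rightarrow> int" where
  "detach w i = (if i = 0 then 0 else w (i + 2) - 2 * sgn (w (i + 2)))"

lemma attach_simps:
  "attach a b v (Suc 0) = a" "attach a b v 2 = b"
  "k \<ge> 1 \<Longrightarrow> attach a b v (k + 2) = v k + 2 * sgn (v k)"
  by (auto simp: attach_def)

lemma attach_zero: "v 0 = 0 \<Longrightarrow> attach a b v 0 = 0"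
  by (simp add: attach_def)

lemma abs_attach: "\<bar>attach a b v i\<bar> = attach \<bar>a\<bar> \<bar>b\<bar> (\<lambda>i. \<bar>v i\<bar>) i"
  by (auto simp: attach_def sgn_if)

lemma attach_perms:
  assumes u: "u \<in> perms m" and pq: "p = 1 \<and> q = 2 \<or> p = 2 \<and> q = 1"
  shows "attach p q u \<in> perms (m + 2)"
proof -
  note us = perms_signed[OF u]
  have nonneg: "0 \<le> attach p q u i" for i
    using u pq by (auto simp: perms_def attach_def sgn_if intro!: add_nonneg_nonneg)
      (metis linorder_not_less order_less_le)+
  \<comment> \<open>Beyond the first two positions the letters are at least 3, hence distinct from
    \<open>p\<close> and \<open>q\<close>.\<close>
  have large: "attach p q u i = u (i - 2) + 2 \<and> i - 2 \<in> {1..m} \<and> u (i - 2) \<in> {1..int m}"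
    if "i \<in> {1..m + 2}" "i \<noteq> 1" "i \<noteq> 2" for i
  proof -
    have "i - 2 \<in> {1..m}" using that by auto
    with signed_perms_range[OF us this] show ?thesis
      using that by (auto simp: attach_def perms_abs[OF u] sgn_if)
  qed
  have "attach p q u \<in> signed_perms (m + 2)"
  proof (rule signed_permsI)
    fix i :: nat assume "i \<notin> {1..m + 2}"
    then have "i - 2 \<notin> {1..m}" "i \<noteq> 1" "i \<noteq> 2" by auto
    then show "attach p q u i = 0"
      using signed_perms_outside[OF us, of "i - 2"] by (simp add: attach_def)
  next
    fix i assume "i \<in> {1..m + 2}"
    then show "\<bar>attach p q u i\<bar> \<in> {1..int (m + 2)}"
      using large[of i] pq by (cases "i = 1 \<or> i = 2") (auto simp: attach_def)
  next
    fix i j assume ij: "i \<in> {1..m + 2}" "j \<in> {1..m + 2}"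
      and "\<bar>attach p q u i\<bar> = \<bar>attach p q u j\<bar>"
    then have eq: "attach p q u i = attach p q u j" using nonneg by simp
    show "i = j"
    proof (cases "i = 1 \<or> i = 2 \<or> j = 1 \<or> j = 2")
      case True
      then show ?thesis
        using eq pq large[OF ij(1)] large[OF ij(2)]
        by (cases "i = 1 \<or> i = 2"; cases "j = 1 \<or> j = 2") (auto simp: attach_simps)
    next
      case False
      then have "i - 2 = j - 2"
        using large[OF ij(1)] large[OF ij(2)] eq by (intro signed_perms_inj[OF us]) auto
      then show ?thesis using False ij by auto
    qed
  qed
  then show ?thesis using nonneg by (simp add: perms_def)
qed

lemma attach_signed_perms:
  assumes "v \<in> signed_perms m" "\<bar>a\<bar> = 1 \<and> \<bar>b\<bar> = 2 \<or> \<bar>a\<bar> = 2 \<and> \<bar>b\<bar> = 1"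
  shows "attach a b v \<in> signed_perms (m + 2)"
  using assms attach_perms[of "\<lambda>i. \<bar>v i\<bar>" m "\<bar>a\<bar>" "\<bar>b\<bar>"]
  by (simp add: signed_perms_iff_abs abs_attach)

lemma detach_attach: "v 0 = 0 \<Longrightarrow> detach (attach a b v) = v"
  by (auto simp: detach_def attach_def sgn_if)

text \<open>The assumption on \<open>\<bar>w i\<bar>\<close> makes each letter after the second
  either 0 or of absolute value above 2, so moving it towards 0 by two preserves its sign.\<close>

lemma attach_detach:
  assumes "\<And>i. \<bar>w i\<bar> = attach p q u i" "u 0 = 0" "\<And>i. u i \<ge> 0"
  shows "attach (w 1) (w 2) (detach w) = w" "\<bar>detach w i\<bar> = u i"
proof -
  have *: "\<bar>w (k + 2)\<bar> = u k + 2 * sgn (u k)" if "k \<ge> 1" for k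
    using assms(1)[of "k + 2"] attach_simps(3)[OF that] by simp
  show "\<bar>detach w i\<bar> = u i"
  proof (cases "i = 0")
    case False
    then show ?thesis
      using *[of i] assms(3)[of i] by (auto simp: detach_def sgn_if split: if_splits)
  qed (simp add: detach_def assms(2))
  show "attach (w 1) (w 2) (detach w) = w"
  proof
    fix j :: nat
    have "j = 0 \<or> j = 1 \<or> j = 2 \<or> (\<exists>k\<ge>1. j = k + 2)" by presburger
    then consider "j = 0" | "j = 1" | "j = 2" | k where "j = k + 2" "k \<ge> 1" by blast
    then show "attach (w 1) (w 2) (detach w) j = w j"
    proof cases
      case 1
      then show ?thesis using assms(1)[of 0] assms(2) by (simp add: attach_def detach_def)
    next
      case (4 k)
      then show ?thesis
        using *[of k] assms(3)[of k] attach_simps(3)[of k "w 1" "w 2" "detach w"]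
        by (auto simp: detach_def sgn_if split: if_splits)
    qed (simp_all add: attach_simps)
  qed
qed

definition sign_sum :: "int \<Rightarrow> int \<Rightarrow> ((nat \<Rightarrow> int) \<Rightarrow> rat) \<Rightarrow> (nat \<Rightarrow> int) \<Rightarrow> rat" where
  "sign_sum p q x v = x (attach p q v) + x (attach p (- q) v)
    + x (attach (- p) q v) + x (attach (- p) (- q) v)"

text \<open>The fibre over \<open>attach p q u\<close> is the product of the four sign choices for
  the two leading letters with the fibre over \<open>u\<close>.\<close>

lemma forget_attach:
  assumes u: "u \<in> perms m" and pq: "p = 1 \<and> q = 2 \<or> p = 2 \<and> q = 1"
  shows "forget (m + 2) x (attach p q u)
    = (\<Sum>v | v \<in> signed_perms m \<and> (\<lambda>i. \<bar>v i\<bar>) = u. sign_sum p q x v)"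
proof -
  let ?V = "{v \<in> signed_perms m. (\<lambda>i. \<bar>v i\<bar>) = u}"
  have u0: "u 0 = 0" using signed_perms_outside[OF perms_signed[OF u], of 0] by simp
  have v0: "v 0 = 0" if "v \<in> ?V" for v using that u0 by auto
  have "forget (m + 2) x (attach p q u)
      = (\<Sum>(a, b, v)\<in>{p, - p} \<times> {q, - q} \<times> ?V. x (attach a b v))"
    unfolding forget_def
  proof (rule sum.reindex_bij_witness[where j = "\<lambda>w. (w 1, w 2, detach w)"
        and i = "\<lambda>(a, b, v). attach a b v"])
    fix w assume "w \<in> {w \<in> signed_perms (m + 2). (\<lambda>i. \<bar>w i\<bar>) = attach p q u}"
    then have w: "\<And>i. \<bar>w i\<bar> = attach p q u i" by (auto dest: fun_cong)
    have "0 \<le> u i" for i using u by (simp add: perms_def)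
    note d = attach_detach[of w p q u, OF w u0 this]
    have "\<bar>w 1\<bar> = p" "\<bar>w 2\<bar> = q" using w[of 1] w[of 2] by (simp_all add: attach_simps)
    moreover have "detach w \<in> signed_perms m" using u by (simp add: signed_perms_iff_abs d(2))
    ultimately show "(w 1, w 2, detach w) \<in> {p, - p} \<times> {q, - q} \<times> ?V"
      using d(2) by (auto simp: abs_if)
    show "(case (w 1, w 2, detach w) of (a, b, v) \<Rightarrow> attach a b v) = w"
      using d(1) by simp
    show "(case (w 1, w 2, detach w) of (a, b, v) \<Rightarrow> x (attach a b v)) = x w"
      using d(1) by simp
  next
    fix t assume "t \<in> {p, - p} \<times> {q, - q} \<times> ?V"
    then obtain a b v where t: "t = (a, b, v)" "a \<in> {p, - p}" "b \<in> {q, - q}" "v \<in> ?V"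
      by auto
    then have ab: "\<bar>a\<bar> = p" "\<bar>b\<bar> = q" using pq by auto
    show "(case t of (a, b, v) \<Rightarrow> attach a b v)
        \<in> {w \<in> signed_perms (m + 2). (\<lambda>i. \<bar>w i\<bar>) = attach p q u}"
      using t ab pq attach_signed_perms[of v m a b] by (auto simp: abs_attach)
    show "(\<lambda>w. (w 1, w 2, detach w)) (case t of (a, b, v) \<Rightarrow> attach a b v) = t"
      using t v0 by (simp add: attach_simps detach_attach)
  qed
  also have "\<dots> = (\<Sum>a\<in>{p, - p}. \<Sum>b\<in>{q, - q}. \<Sum>v\<in>?V. x (attach a b v))"
    by (simp only: sum.cartesian_product case_prod_unfold)
  also have "\<dots> = (\<Sum>v\<in>?V. sign_sum p q x v)"
    using pq by (auto simp: sign_sum_def sum.distrib)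
  finally show ?thesis .
qed

text \<open>The element \<open>v\<close> of \<open>B\<^sub>m\<close> is prolonged by the letters \<open>\<plusminus>1, \<plusminus>2\<close> in front.
  Exactly one prolongation in \<open>D\<^bsub>m+2\<^esub>\<close> adds each subset of \<open>{1', 1}\<close> to the (shifted)
  descent set; it enters with sign \<open>(-1)\<close> to the size of that subset, whence \<open>X\<^sub>J\<close> is killed
  unless \<open>1', 1 \<notin> J\<close>.\<close>

definition gamma :: "nat \<Rightarrow> ((nat \<Rightarrow> int) \<Rightarrow> rat) \<Rightarrow> (nat \<Rightarrow> int) \<Rightarrow> rat" where
  "gamma m x v = (if v \<in> signed_perms m then sign_sum 1 2 x v - sign_sum 2 1 x v else 0)"

definition pi_map :: "nat \<Rightarrow> ((nat \<Rightarrow> int) \<Rightarrow> rat) \<Rightarrow> (nat \<Rightarrow> int) \<Rightarrow> rat" where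
  "pi_map m x u = (if u \<in> perms m then x (attach 1 2 u) - x (attach 2 1 u) else 0)"

lemma linear_gamma: "linear_on UNIV (gamma m)"
  by (auto simp: linear_on_def gamma_def sign_sum_def algebra_simps)

lemma linear_pi_map: "linear_on UNIV (pi_map m)"
  by (auto simp: linear_on_def pi_map_def algebra_simps)

text \<open>\<open>forget_attach\<close> turns both coefficients in \<open>pi_map\<close> into sums
  over the fibre of \<open>u\<close>, whose difference is the sum of \<open>gamma m x\<close> over
  it. No condition on \<open>x\<close> enters.\<close>

lemma pi_map_forget: "pi_map m (forget (m + 2) x) = forget m (gamma m x)"
proof
  fix u
  show "pi_map m (forget (m + 2) x) u = forget m (gamma m x) u"
  proof (cases "u \<in> perms m")
    case False
    then show ?thesis by (simp add: pi_map_def forget_outside)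
  next
    case True
    have "forget m (gamma m x) u = (\<Sum>v | v \<in> signed_perms m \<and> (\<lambda>i. \<bar>v i\<bar>) = u.
        sign_sum 1 2 x v - sign_sum 2 1 x v)"
      unfolding forget_def by (intro sum.cong) (auto simp: gamma_def)
    then show ?thesis
      using True forget_attach[OF True, of 1 2 x] forget_attach[OF True, of 2 1 x]
      by (simp add: pi_map_def sum_subtractf)
  qed
qed

section \<open>Descents and peaks of prolongations\<close>

lemma sign_prod_attach: "sign_prod (m + 2) (attach a b v) = sgn a * sgn b * sign_prod m v"
proof -
  define A where "A = (\<lambda>i. i + 2) ` {1..m}"
  have A: "finite A" "1 \<notin> insert 2 A" "2 \<notin> A" by (auto simp: A_def)
  have "{1..m + 2} = insert 1 (insert 2 A)"
    unfolding A_def image_add_atLeastAtMost' by auto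
  then have "sign_prod (m + 2) (attach a b v) = (\<Prod>i\<in>insert 1 (insert 2 A). sgn (attach a b v i))"
    by (simp only: sign_prod_def)
  also have "\<dots> = sgn a * sgn b * (\<Prod>i\<in>A. sgn (attach a b v i))"
    using A by (simp add: attach_simps)
  also have "(\<Prod>i\<in>A. sgn (attach a b v i)) = (\<Prod>i\<in>{1..m}. sgn (attach a b v (i + 2)))"
    unfolding A_def by (subst prod.reindex) (auto simp: inj_on_def)
  also have "\<dots> = sign_prod m v"
    unfolding sign_prod_def
  proof (intro prod.cong refl)
    fix i assume "i \<in> {1..m}"
    then have "attach a b v (i + 2) = v i + 2 * sgn (v i)" by (intro attach_simps(3)) simp
    then show "sgn (attach a b v (i + 2)) = sgn (v i)" by (simp add: sgn_if)
  qed
  finally show ?thesis .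
qed

text \<open>Moving nonzero letters away from 0 preserves their order. At \<open>k = 0\<close> the
  letter \<open>b\<close> stands in for \<open>v 0 = 0\<close>; with
  \<open>\<bar>b\<bar> \<le> 2\<close> it still separates negative from positive moved
  letters.\<close>

lemma attach_less_iff:
  assumes "v \<in> signed_perms m" "\<bar>b\<bar> \<le> 2" "k < m"
  shows "attach a b v (Suc (k + 2)) < attach a b v (k + 2) \<longleftrightarrow> v (Suc k) < v k"
    and "attach a b v (k + 2) < attach a b v (Suc (k + 2)) \<longleftrightarrow> v k < v (Suc k)"
proof -
  have S: "attach a b v (Suc (k + 2)) = v (Suc k) + 2 * sgn (v (Suc k))"
    using attach_simps(3)[of "Suc k" a b v] by simp
  have nz: "v (Suc k) \<noteq> 0" using signed_perms_nonzero[OF assms(1), of "Suc k"] assms(3) by simp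
  have "(attach a b v (Suc (k + 2)) < attach a b v (k + 2) \<longleftrightarrow> v (Suc k) < v k)
    \<and> (attach a b v (k + 2) < attach a b v (Suc (k + 2)) \<longleftrightarrow> v k < v (Suc k))"
  proof (cases "k = 0")
    case True
    then have "k + 2 = 2" "v k = 0"
      using signed_perms_outside[OF assms(1), of 0] by simp_all
    then have "attach a b v (k + 2) = b" "v k = 0" by (simp_all only: attach_simps)
    then show ?thesis using S nz assms(2) by (auto simp: sgn_if)
  next
    case False
    then have "attach a b v (k + 2) = v k + 2 * sgn (v k)" "v k \<noteq> 0"
      using signed_perms_nonzero[OF assms(1), of k] assms(3) attach_simps(3)[of k a b v]
      by simp_all
    then show ?thesis using S nz by (auto simp: sgn_if)
  qed
  then show "attach a b v (Suc (k + 2)) < attach a b v (k + 2) \<longleftrightarrow> v (Suc k) < v k"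
    "attach a b v (k + 2) < attach a b v (Suc (k + 2)) \<longleftrightarrow> v k < v (Suc k)" by auto
qed

lemma DesD_attach_subset_iff:
  assumes "v \<in> signed_perms m" "\<bar>b\<bar> \<le> 2"
  shows "DesD (m + 2) (attach a b v) \<subseteq> J \<longleftrightarrow>
    (- a > b \<longrightarrow> 0 \<in> J) \<and> (a > b \<longrightarrow> 1 \<in> J) \<and> (\<lambda>i. i + 2) ` DesB m v \<subseteq> J"
proof -
  have "{2..<m + 2} = (\<lambda>i. i + 2) ` {0..<m}"
    by (simp only: image_add_atLeastLessThan' add_0)
  then have "(\<forall>i\<in>{2..<m + 2}. attach a b v i > attach a b v (Suc i) \<longrightarrow> i \<in> J)
      \<longleftrightarrow> (\<forall>k\<in>{0..<m}. attach a b v (k + 2) > attach a b v (Suc (k + 2)) \<longrightarrow> k + 2 \<in> J)"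
    by (simp only: ball_simps)
  also have "\<dots> \<longleftrightarrow> (\<forall>k\<in>{0..<m}. v k > v (Suc k) \<longrightarrow> k + 2 \<in> J)"
    by (intro ball_cong refl) (simp only: attach_less_iff[OF assms] atLeastLessThan_iff)
  also have "\<dots> \<longleftrightarrow> (\<lambda>i. i + 2) ` DesB m v \<subseteq> J" by (auto simp: DesB_def)
  finally show ?thesis
    using DesD_subset_iff[of "m + 2" "attach a b v" J] by (simp add: attach_simps)
qed

lemma XD_attach:
  assumes "v \<in> signed_perms m" "\<bar>a\<bar> = 1 \<and> \<bar>b\<bar> = 2 \<or> \<bar>a\<bar> = 2 \<and> \<bar>b\<bar> = 1"
  shows "XD (m + 2) J (attach a b v) = of_bool (sgn a * sgn b * sign_prod m v = 1 \<and>
    (- a > b \<longrightarrow> 0 \<in> J) \<and> (a > b \<longrightarrow> 1 \<in> J) \<and> (\<lambda>i. i + 2) ` DesB m v \<subseteq> J)"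
proof -
  have "\<bar>b\<bar> \<le> 2" using assms(2) by auto
  note DesD_attach_subset_iff[OF assms(1) this]
  moreover have "attach a b v \<in> Dperms (m + 2) \<longleftrightarrow> sgn a * sgn b * sign_prod m v = 1"
    using attach_signed_perms[OF assms] by (simp only: Dperms_iff_sign_prod sign_prod_attach simp_thms)
  ultimately show ?thesis by (simp only: XD_def of_bool_def)
qed

lemma gamma_XD:
  "gamma m (XD (m + 2) J)
    = (if 0 \<notin> J \<and> 1 \<notin> J then XB m ((\<lambda>j. j - 2) ` J) else (\<lambda>_. 0))"
proof
  fix v
  show "gamma m (XD (m + 2) J) v
    = (if 0 \<notin> J \<and> 1 \<notin> J then XB m ((\<lambda>j. j - 2) ` J) else (\<lambda>_. 0)) v"
  proof (cases "v \<in> signed_perms m")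
    case False
    then show ?thesis by (simp add: gamma_def XB_def)
  next
    case True
    let ?T = "(\<lambda>i. i + 2) ` DesB m v \<subseteq> J"
    define n where "n = m + 2"
    note XD_n = XD_attach[OF True, folded n_def]
    \<comment> \<open>For either sign of \<open>v\<close>, four prolongations have even parity. If
      \<open>?T\<close> holds, their signed sum is
      \<open>(1 - of_bool (0 \<in> J)) * (1 - of_bool (1 \<in> J))\<close>; otherwise all terms
      vanish.\<close>
    from sign_prod_cases[OF True]
    have "gamma m (XD n J) v = of_bool (0 \<notin> J \<and> 1 \<notin> J \<and> ?T)"
      by (rule disjE) (simp_all add: gamma_def sign_sum_def XD_n True of_bool_def)
    moreover have "?T \<longleftrightarrow> DesB m v \<subseteq> (\<lambda>j. j - 2) ` J" if J: "0 \<notin> J" "1 \<notin> J"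
    proof -
      have "i \<in> (\<lambda>j. j - 2) ` J \<longleftrightarrow> i + 2 \<in> J" for i
      proof
        assume "i \<in> (\<lambda>j. j - 2) ` J"
        then obtain j where "j \<in> J" "i = j - 2" by blast
        moreover have "j \<noteq> 0" "j \<noteq> 1" using J \<open>j \<in> J\<close> by metis+
        ultimately have "i + 2 = j" by linarith
        then show "i + 2 \<in> J" using \<open>j \<in> J\<close> by (simp only:)
      qed force
      then show ?thesis by blast
    qed
    ultimately show ?thesis unfolding n_def using True by (auto simp: XB_def)
  qed
qed

text \<open>The two leading letters lie below all later ones, so 2 is never a peak, and 1 is a peak
  only for the order 2, 1.\<close>

lemma Peak_attach:
  assumes u: "u \<in> perms m" and pq: "p = 1 \<and> q = 2 \<or> p = 2 \<and> q = 1"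
  shows "Peak (m + 2) (attach p q u) = (if p > q then {1} else {}) \<union> (\<lambda>i. i + 2) ` Peak m u"
proof -
  note us = perms_signed[OF u]
  have u0: "u 0 = 0" using signed_perms_outside[OF us, of 0] by simp
  have q: "\<bar>q\<bar> \<le> 2" using pq by auto
  have up: "q < attach p q u 3" if "0 < m"
  proof -
    have "0 < u 1"
      using signed_perms_nonzero[OF us, of 1] perms_abs[OF u, of 1] that by auto
    moreover have "attach p q u 3 = u 1 + 2 * sgn (u 1)" by (simp add: attach_def)
    ultimately show ?thesis using pq by auto
  qed
  have "i \<in> Peak (m + 2) (attach p q u)
      \<longleftrightarrow> i \<in> (if p > q then {1} else {}) \<union> (\<lambda>i. i + 2) ` Peak m u" for i
  proof -
    have "i = 0 \<or> i = 1 \<or> i = 2 \<or> (\<exists>k\<ge>1. i = k + 2)" by presburger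
    then consider "i = 0" | "i = 1" | "i = 2" | k where "i = k + 2" "k \<ge> 1" by blast
    then show ?thesis
    proof cases
      case 1
      then show ?thesis by (auto simp: Peak_def)
    next
      case 2
      then show ?thesis
        using pq u0 attach_simps(2)[of p q u, unfolded numeral_2_eq_2]
        by (auto simp: Peak_def attach_simps(1) attach_zero)
    next
      case 3
      then show ?thesis using up by (auto simp: Peak_def attach_simps)
    next
      case (4 k)
      \<comment> \<open>The left neighbour has index \<open>j\<close>, possibly 0, where
        \<open>q\<close> takes the place of \<open>u 0\<close>.\<close>
      then obtain j where j: "k = Suc j" by (cases k) auto
      have "i \<in> Peak (m + 2) (attach p q u) \<longleftrightarrow> k < m \<and>
          attach p q u (j + 2) < attach p q u (Suc (j + 2)) \<and>
          attach p q u (Suc (k + 2)) < attach p q u (k + 2)"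
        using 4 j by (auto simp: Peak_def)
      also have "\<dots> \<longleftrightarrow> k < m \<and> u j < u (Suc j) \<and> u (Suc k) < u k"
        using attach_less_iff[OF us q, of j p] attach_less_iff[OF us q, of k p] j by auto
      also have "\<dots> \<longleftrightarrow> k \<in> Peak m u" using 4 j by (auto simp: Peak_def)
      finally show ?thesis using 4 by auto
    qed
  qed
  then show ?thesis by blast
qed

lemma shift_image_iff:
  assumes "F \<in> peak_sets n" "1 \<notin> F" "2 \<notin> F"
  shows "A = (\<lambda>j. j - 2) ` F \<longleftrightarrow> (\<lambda>i. i + 2) ` A = F"
proof
  have ge: "j - 2 + 2 = j" if "j \<in> F" for j
    using assms that by (cases "j = 0 \<or> j = 1") (auto simp: peak_sets_def)
  assume "A = (\<lambda>j. j - 2) ` F"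
  then show "(\<lambda>i. i + 2) ` A = F" using ge by (simp add: image_image)
next
  assume "(\<lambda>i. i + 2) ` A = F"
  then have "(\<lambda>j. j - 2) ` F = (\<lambda>j. j - 2) ` (\<lambda>i. i + 2) ` A" by simp
  also have "\<dots> = A" by (simp add: image_image)
  finally show "A = (\<lambda>j. j - 2) ` F" by simp
qed

lemma pi_map_PF:
  assumes F: "F \<in> peak_sets (m + 2)"
  shows "pi_map m (PF (m + 2) F) =
    (if 1 \<notin> F \<and> 2 \<notin> F then PF m ((\<lambda>j. j - 2) ` F)
     else if 1 \<in> F then (\<lambda>u. - PF m ((\<lambda>j. j - 2) ` (F - {1})) u)
     else (\<lambda>_. 0))"
proof
  fix u
  show "pi_map m (PF (m + 2) F) u =
    (if 1 \<notin> F \<and> 2 \<notin> F then PF m ((\<lambda>j. j - 2) ` F)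
     else if 1 \<in> F then (\<lambda>u. - PF m ((\<lambda>j. j - 2) ` (F - {1})) u)
     else (\<lambda>_. 0)) u"
  proof (cases "u \<in> perms m")
    case False
    then show ?thesis by (simp add: pi_map_def PF_def)
  next
    case u: True
    let ?P = "(\<lambda>i. i + 2) ` Peak m u"
    \<comment> \<open>The prolongations have peak sets \<open>?P\<close> and
      \<open>insert 1 ?P\<close>; the negative sign in the case \<open>1 \<in> F\<close> is that of
      the second one.\<close>
    have eq: "pi_map m (PF (m + 2) F) u = of_bool (?P = F) - of_bool (insert 1 ?P = F)"
      using u Peak_attach[OF u, of 1 2] Peak_attach[OF u, of 2 1]
        attach_perms[OF u, of 1 2] attach_perms[OF u, of 2 1]
      by (simp add: pi_map_def PF_def)
    have P: "1 \<notin> ?P" "2 \<notin> ?P" by (auto simp: Peak_def)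
    consider "1 \<notin> F" "2 \<notin> F" | "1 \<in> F" "2 \<notin> F" | "1 \<notin> F" "2 \<in> F"
      using F by (force simp: peak_sets_def numeral_2_eq_2)
    then show ?thesis
    proof cases
      case 1
      have "insert 1 ?P \<noteq> F" using 1 by blast
      then show ?thesis
        using 1 u unfolding eq by (simp add: PF_def shift_image_iff[OF F 1])
    next
      case 2
      have F': "F - {1} \<in> peak_sets (m + 2)" using F by (auto simp: peak_sets_def)
      have "?P \<noteq> F" "insert 1 ?P = F \<longleftrightarrow> ?P = F - {1}" using 2 P by blast+
      then show ?thesis
        using 2 u shift_image_iff[OF F', of "Peak m u"] unfolding eq by (simp add: PF_def)
    next
      case 3
      have "?P \<noteq> F" "insert 1 ?P \<noteq> F" using 3 P by auto
      then show ?thesis using 3 unfolding eq by simp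
    qed
  qed
qed

text \<open>The peak sets of the two prolongations differ only in 1, which interior peaks ignore, so
  the coefficients cancel.\<close>

lemma pi_map_PFring: "pi_map m (PFring (m + 2) F) = (\<lambda>_. 0)"
proof
  fix u
  show "pi_map m (PFring (m + 2) F) u = 0"
    using Peak_attach[of u m 1 2] Peak_attach[of u m 2 1]
      attach_perms[of u m 1 2] attach_perms[of u m 2 1]
    by (simp add: pi_map_def PFring_def)
qed

section \<open>Exactness\<close>

declare add_2_eq_Suc [simp del] add_2_eq_Suc' [simp del]

text \<open>For \<open>K \<subseteq> {0..<m}\<close>, a representative with descent set
  \<open>K\<close>: absolute values increase, so a descent occurs exactly in front of a negative
  letter.\<close>

definition desc_perm :: "nat \<Rightarrow> nat set \<Rightarrow> nat \<Rightarrow> int" where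
  "desc_perm m K i = (if i \<notin> {1..m} then 0 else if i - 1 \<in> K then - int i else int i)"

lemma desc_perm:
  assumes "K \<subseteq> {0..<m}"
  shows "desc_perm m K \<in> signed_perms m" "DesB m (desc_perm m K) = K"
proof -
  show "desc_perm m K \<in> signed_perms m"
    by (rule signed_permsI) (auto simp: desc_perm_def split: if_splits)
  have "desc_perm m K i > desc_perm m K (Suc i) \<longleftrightarrow> i \<in> K" if "i < m" for i
    using that by (auto simp: desc_perm_def)
  then show "DesB m (desc_perm m K) = K" using assms by (auto simp: DesB_def)
qed

text \<open>Elements of \<open>SigmaB m\<close> are constant on descent classes, so evaluation at
  \<open>desc_perm\<close> reads off their values. This gives a linear map on all functions without
  choosing a basis.\<close>

definition gamma_section :: "nat \<Rightarrow> ((nat \<Rightarrow> int) \<Rightarrow> rat) \<Rightarrow> (nat \<Rightarrow> int) \<Rightarrow> rat" where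
  "gamma_section m y w =
    (if w \<in> Dperms (m + 2) \<and> 0 \<notin> DesD (m + 2) w \<and> 1 \<notin> DesD (m + 2) w
     then y (desc_perm m ((\<lambda>j. j - 2) ` DesD (m + 2) w)) else 0)"

text \<open>The same device for peak classes, represented by \<open>peak_perm\<close>.\<close>

definition pi_section :: "nat \<Rightarrow> ((nat \<Rightarrow> int) \<Rightarrow> rat) \<Rightarrow> (nat \<Rightarrow> int) \<Rightarrow> rat" where
  "pi_section m y u =
    (if u \<in> perms (m + 2) \<and> 1 \<notin> Peak (m + 2) u \<and> 2 \<notin> Peak (m + 2) u
     then y (peak_perm m ((\<lambda>j. j - 2) ` Peak (m + 2) u)) else 0)"

lemma linear_gamma_section: "linear_on UNIV (gamma_section m)"
  by (auto simp: linear_on_def gamma_section_def)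

lemma linear_pi_section: "linear_on UNIV (pi_section m)"
  by (auto simp: linear_on_def pi_section_def)

lemma shift_subset_iff:
  assumes "0 \<notin> A" "1 \<notin> A" "0 \<notin> B" "1 \<notin> B"
  shows "(\<lambda>j. j - 2) ` A \<subseteq> (\<lambda>j. j - 2 :: nat) ` B \<longleftrightarrow> A \<subseteq> B"
proof -
  have ge: "2 \<le> j" if "j \<in> A \<union> B" for j
    using assms that by (cases "j = 0 \<or> j = 1") auto
  have "a = b" if "a \<in> A" "b \<in> B" "a - 2 = b - 2" for a b
    using ge[of a] ge[of b] that by auto
  then show ?thesis by (auto simp: subset_eq image_iff) metis
qed

lemma gamma_section_XB:
  assumes J: "J \<subseteq> {0..<m + 2}" "0 \<notin> J" "1 \<notin> J"
  shows "gamma_section m (XB m ((\<lambda>j. j - 2) ` J)) = XD (m + 2) J"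
proof
  fix w
  let ?D = "DesD (m + 2) w"
  show "gamma_section m (XB m ((\<lambda>j. j - 2) ` J)) w = XD (m + 2) J w"
  proof (cases "0 \<in> ?D \<or> 1 \<in> ?D")
    case True
    then have "\<not> ?D \<subseteq> J" using J by blast
    then show ?thesis using True by (auto simp: gamma_section_def XD_def)
  next
    case False
    have "?D \<subseteq> {0..<m + 2}" by (auto simp: DesD_def)
    moreover have "2 \<le> j" if "j \<in> ?D" for j
      using False that by (cases "j = 0 \<or> j = 1") auto
    ultimately have "(\<lambda>j. j - 2) ` ?D \<subseteq> {0..<m}" by fastforce
    then show ?thesis
      using False J desc_perm[of "(\<lambda>j. j - 2) ` ?D" m] shift_subset_iff[of ?D J]
      by (simp add: gamma_section_def XD_def XB_def)
  qed
qed

lemma peak_sets_shift_down: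
  assumes "F \<in> peak_sets (m + 2)" "1 \<notin> F" "2 \<notin> F"
  shows "(\<lambda>j. j - 2) ` F \<in> peak_sets m"
proof -
  have ge: "3 \<le> j \<and> j < m + 2 \<and> Suc j \<notin> F" if "j \<in> F" for j
    using assms that by (cases "j = 1 \<or> j = 2") (auto simp: peak_sets_def)
  have "Suc (j - 2) \<noteq> k - 2" if "j \<in> F" "k \<in> F" for j k
  proof
    assume "Suc (j - 2) = k - 2"
    then have "k = Suc j" using ge[OF that(1)] ge[OF that(2)] by linarith
    then show False using ge[OF that(1)] that(2) by simp
  qed
  moreover have "(\<lambda>j. j - 2) ` F \<subseteq> {1..<m}" using ge by fastforce
  ultimately show ?thesis by (auto simp: peak_sets_def)
qed

lemma pi_section_PF:
  assumes F: "F \<in> peak_sets (m + 2)" "1 \<notin> F" "2 \<notin> F"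
  shows "pi_section m (PF m ((\<lambda>j. j - 2) ` F)) = PF (m + 2) F"
proof
  fix u
  let ?P = "Peak (m + 2) u"
  show "pi_section m (PF m ((\<lambda>j. j - 2) ` F)) u = PF (m + 2) F u"
  proof (cases "1 \<in> ?P \<or> 2 \<in> ?P")
    case True
    then have "?P \<noteq> F" using F by blast
    then show ?thesis using True by (auto simp: pi_section_def PF_def)
  next
    case False
    then have P: "1 \<notin> ?P" "2 \<notin> ?P" by auto
    have "0 \<notin> ?P" "0 \<notin> F" using F by (auto simp: Peak_def peak_sets_def)
    then have "(\<lambda>j. j - 2) ` ?P = (\<lambda>j. j - 2) ` F \<longleftrightarrow> ?P = F"
      using shift_subset_iff[of ?P F] shift_subset_iff[of F ?P] P F(2,3) by blast
    then have "PF m ((\<lambda>j. j - 2) ` F) (peak_perm m ((\<lambda>j. j - 2) ` ?P)) = of_bool (?P = F)"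
      using peak_perm[OF peak_sets_shift_down[OF Peak_in_peak_sets P]] by (simp add: PF_def)
    then show ?thesis
      using P by (cases "?P = F") (simp_all add: pi_section_def PF_def[of "m + 2"])
  qed
qed

section \<open>Kernels and images of the two maps\<close>

lemma kernel_gamma: "{x \<in> SigmaD (m + 2). gamma m x = (\<lambda>_. 0)} = Iideal (m + 2)"
  unfolding SigmaD_def Iideal_def
proof (rule kernel_qspan[OF linear_gamma linear_gamma_section])
  let ?T = "{XD (m + 2) J | J. J \<subseteq> {0..<m + 2} \<and> (0 \<in> J \<or> 1 \<in> J)}"
  show "?T \<subseteq> qspan {XD (m + 2) J | J. J \<subseteq> {0..<m + 2}}" by (auto intro: qspan_base)
  show "gamma m x = (\<lambda>_. 0)" if "x \<in> ?T" for x using that by (auto simp: gamma_XD)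
  fix x assume "x \<in> {XD (m + 2) J | J. J \<subseteq> {0..<m + 2}}"
  then obtain J where J: "x = XD (m + 2) J" "J \<subseteq> {0..<m + 2}" by blast
  show "(\<lambda>w. x w - gamma_section m (gamma m x) w) \<in> qspan ?T"
  \<comment> \<open>Generators of the ideal are killed by \<open>gamma m\<close> and left unchanged
    by the projection; all others are recovered by the section and projected to 0.\<close>
  proof (cases "0 \<in> J \<or> 1 \<in> J")
    case True
    then have "gamma m x = (\<lambda>_. 0)" using J by (auto simp: gamma_XD)
    moreover have "x \<in> qspan ?T" using J True by (intro qspan_base) blast
    ultimately show ?thesis by (simp add: linear_on_zero[OF linear_gamma_section])
  next
    case False
    then have "gamma_section m (gamma m x) = x"
      using J gamma_section_XB[of J m] by (simp add: gamma_XD)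
    then show ?thesis by (simp add: qspan_zero)
  qed
qed

lemma image_gamma: "gamma m ` SigmaD (m + 2) = SigmaB m"
  unfolding SigmaD_def SigmaB_def
proof (intro equalityI linear_image_qspan_subset qspan_subset_linear_image linear_gamma)
  fix x assume "x \<in> {XD (m + 2) J | J. J \<subseteq> {0..<m + 2}}"
  then obtain J where J: "x = XD (m + 2) J" "J \<subseteq> {0..<m + 2}" by blast
  show "gamma m x \<in> qspan {XB m J | J. J \<subseteq> {0..<m}}"
  proof (cases "0 \<in> J \<or> 1 \<in> J")
    case True
    then have "gamma m x = (\<lambda>_. 0)" using J by (auto simp: gamma_XD)
    then show ?thesis by (simp add: qspan_zero)
  next
    case False
    then have "2 \<le> j" if "j \<in> J" for j using that by (cases "j = 0 \<or> j = 1") auto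
    then have "(\<lambda>j. j - 2) ` J \<subseteq> {0..<m}" using J by fastforce
    moreover have "gamma m x = XB m ((\<lambda>j. j - 2) ` J)" using False J by (simp add: gamma_XD)
    ultimately show ?thesis by (auto intro: qspan_base)
  qed
next
  fix y assume "y \<in> {XB m J | J. J \<subseteq> {0..<m}}"
  then obtain K where K: "y = XB m K" "K \<subseteq> {0..<m}" by blast
  let ?J = "(\<lambda>i. i + 2) ` K"
  have "gamma m (XD (m + 2) ?J) = y" using K by (auto simp: gamma_XD image_image)
  moreover have "?J \<subseteq> {0..<m + 2}" using K by auto
  then have "XD (m + 2) ?J \<in> {XD (m + 2) J | J. J \<subseteq> {0..<m + 2}}" by blast
  then have "XD (m + 2) ?J \<in> qspan {XD (m + 2) J | J. J \<subseteq> {0..<m + 2}}" by (rule qspan_base)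
  ultimately show "y \<in> gamma m ` qspan {XD (m + 2) J | J. J \<subseteq> {0..<m + 2}}" by blast
qed

lemma peak_sets_cases:
  assumes "F \<in> peak_sets n"
  obtains "1 \<notin> F" "2 \<notin> F" | "1 \<in> F" "2 \<notin> F" "F - {1} \<in> peak_sets n" | "1 \<notin> F" "2 \<in> F"
proof -
  have "\<not> (1 \<in> F \<and> 2 \<in> F)" using assms by (force simp: peak_sets_def numeral_2_eq_2)
  moreover have "F - {1} \<in> peak_sets n" using assms by (auto simp: peak_sets_def)
  ultimately show ?thesis using that by blast
qed

lemma kernel_pi_map: "{x \<in> PP (m + 2). pi_map m x = (\<lambda>_. 0)} = PPring (m + 2)"
  unfolding PP_def PPring_def
proof (rule kernel_qspan[OF linear_pi_map linear_pi_section])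
  let ?T = "{PFring (m + 2) F | F. F \<in> peak_sets (m + 2) \<and> 1 \<notin> F}"
  show "?T \<subseteq> qspan {PF (m + 2) F | F. F \<in> peak_sets (m + 2)}"
    using PPring_subset_PP[of "m + 2"] qspan_base[of _ ?T] unfolding PP_def PPring_def by blast
  show "pi_map m x = (\<lambda>_. 0)" if "x \<in> ?T" for x using that pi_map_PFring by blast
  fix x assume "x \<in> {PF (m + 2) F | F. F \<in> peak_sets (m + 2)}"
  then obtain F where x: "x = PF (m + 2) F" and F: "F \<in> peak_sets (m + 2)" by blast
  from F show "(\<lambda>u. x u - pi_section m (pi_map m x) u) \<in> qspan ?T"
  proof (cases rule: peak_sets_cases)
    case 1
    then have "pi_section m (pi_map m x) = x"
      using F pi_section_PF[OF F 1] by (simp add: x pi_map_PF)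
    then show ?thesis by (simp add: qspan_zero)
  next
    case 2
    let ?F = "F - {1}"
    \<comment> \<open>The summand \<open>0 * 0\<close> gives the negative the shape of a combination
      of two functions, to which linearity applies.\<close>
    have "pi_map m x = (\<lambda>u. (- 1) * PF m ((\<lambda>j. j - 2) ` ?F) u + 0 * 0)"
      using 2 F by (simp add: x pi_map_PF)
    then have "pi_section m (pi_map m x)
        = (\<lambda>u. (- 1) * pi_section m (PF m ((\<lambda>j. j - 2) ` ?F)) u + 0 * pi_section m (\<lambda>_. 0) u)"
      by (simp only: linear_on_lincomb[OF linear_pi_section])
    also have "pi_section m (PF m ((\<lambda>j. j - 2) ` ?F)) = PF (m + 2) ?F"
      using 2 by (intro pi_section_PF) auto
    \<comment> \<open>The projection yields \<open>PF (m + 2) F\<close> plus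
      \<open>PF (m + 2) ?F\<close>. As these peak sets differ by the element 1 alone, the sum is an
      interior peak class.\<close>
    finally have "(\<lambda>u. x u - pi_section m (pi_map m x) u) = PFring (m + 2) ?F"
      using 2 by (auto simp: x PF_def PFring_def fun_eq_iff)
    then show ?thesis using 2 by (auto intro: qspan_base)
  next
    case 3
    then have "pi_map m x = (\<lambda>_. 0)" using F by (simp add: x pi_map_PF)
    \<comment> \<open>A peak set containing 2 cannot contain 1, so the peak class of
      \<open>F\<close> is already an interior one.\<close>
    moreover have "A = F \<longleftrightarrow> A - {1} = F" if "A \<in> peak_sets (m + 2)" for A
      by (rule peak_sets_cases[OF that]) (use 3 in auto)
    then have "x = PFring (m + 2) F"
      using Peak_in_peak_sets by (simp add: x PF_def PFring_def)
    then have "x \<in> qspan ?T" using F 3 by (auto intro: qspan_base)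
    ultimately show ?thesis by (simp add: linear_on_zero[OF linear_pi_section])
  qed
qed

lemma image_pi_map: "pi_map m ` PP (m + 2) = PP m"
  unfolding PP_def
proof (intro equalityI linear_image_qspan_subset qspan_subset_linear_image linear_pi_map)
  fix x assume "x \<in> {PF (m + 2) F | F. F \<in> peak_sets (m + 2)}"
  then obtain F where x: "x = PF (m + 2) F" and F: "F \<in> peak_sets (m + 2)" by blast
  have gen: "PF m ((\<lambda>j. j - 2) ` G) \<in> qspan {PF m F | F. F \<in> peak_sets m}"
    if "G \<in> peak_sets (m + 2)" "1 \<notin> G" "2 \<notin> G" for G
    using peak_sets_shift_down[OF that] by (auto intro: qspan_base)
  from F show "pi_map m x \<in> qspan {PF m F | F. F \<in> peak_sets m}"
  proof (cases rule: peak_sets_cases)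
    case 1
    then show ?thesis using F gen[of F] by (simp add: x pi_map_PF)
  next
    case 2
    then show ?thesis
      using F qspan_scale[OF gen[of "F - {1}"], of "- 1"] by (simp add: x pi_map_PF)
  next
    case 3
    then show ?thesis using F by (simp add: x pi_map_PF qspan_zero)
  qed
next
  fix y assume "y \<in> {PF m F | F. F \<in> peak_sets m}"
  then obtain G where G: "y = PF m G" "G \<in> peak_sets m" by blast
  let ?F = "(\<lambda>i. i + 2) ` G"
  have F: "?F \<in> peak_sets (m + 2)" "1 \<notin> ?F" "2 \<notin> ?F"
    using G(2) by (auto simp: peak_sets_def)
  have "pi_map m (PF (m + 2) ?F) = y"
    using F by (simp add: pi_map_PF G(1) image_image)
  moreover have "PF (m + 2) ?F \<in> {PF (m + 2) F | F. F \<in> peak_sets (m + 2)}" using F(1) by blast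
  then have "PF (m + 2) ?F \<in> qspan {PF (m + 2) F | F. F \<in> peak_sets (m + 2)}"
    by (rule qspan_base)
  ultimately show "y \<in> pi_map m ` qspan {PF (m + 2) F | F. F \<in> peak_sets (m + 2)}" by blast
qed

theorem theorem5p12:
  fixes n :: nat
  assumes "n \<ge> 2"
  shows "\<exists>\<gamma> \<pi>.
     linear_on (SigmaD n) \<gamma> \<and>
     (\<forall>J. J \<subseteq> {0..<n} \<longrightarrow>
        \<gamma> (XD n J) = (if 0 \<notin> J \<and> 1 \<notin> J then XB (n - 2) ((\<lambda>j. j - 2) ` J) else (\<lambda>_. 0))) \<and>
     linear_on (PP n) \<pi> \<and>
     (\<forall>F \<in> peak_sets n.
        \<pi> (PF n F) = (if 1 \<notin> F \<and> 2 \<notin> F then PF (n - 2) ((\<lambda>j. j - 2) ` F)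
                      else if 1 \<in> F then (\<lambda>u. - PF (n - 2) ((\<lambda>j. j - 2) ` (F - {1})) u)
                      else (\<lambda>_. 0))) \<and>
     Iideal n \<subseteq> SigmaD n \<and>
     {x \<in> SigmaD n. \<gamma> x = (\<lambda>_. 0)} = Iideal n \<and>
     \<gamma> ` SigmaD n = SigmaB (n - 2) \<and>
     PPring n \<subseteq> PP n \<and>
     {x \<in> PP n. \<pi> x = (\<lambda>_. 0)} = PPring n \<and>
     \<pi> ` PP n = PP (n - 2) \<and>
     forget n ` Iideal n = PPring n \<and>
     forget n ` SigmaD n = PP n \<and>
     forget (n - 2) ` SigmaB (n - 2) = PP (n - 2) \<and>
     (\<forall>x \<in> SigmaD n. \<pi> (forget n x) = forget (n - 2) (\<gamma> x))"
proof -
  obtain m where n: "n = m + 2" using assms by (metis add.commute le_Suc_ex)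
  show ?thesis
    unfolding n add_diff_cancel_right'
    by (intro exI[of _ "gamma m"] exI[of _ "pi_map m"] conjI ballI allI impI)
      (simp_all only: linear_on_subset[OF linear_gamma] linear_on_subset[OF linear_pi_map]
        subset_UNIV gamma_XD pi_map_PF Iideal_subset_SigmaD kernel_gamma image_gamma
        PPring_subset_PP kernel_pi_map image_pi_map forget_Iideal forget_SigmaD le_add2
        forget_SigmaB pi_map_forget)
qed

end
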